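(* (Provable in $\mathsf{RCA}_0^\omega$.) Let $D\subseteq 2^{\mathbb{N}}$ be an RM-closed set and let $f$ be an RM-code of a continuous partial function from $2^{\mathbb{N}}$ to $\mathbb{N}$ defined on $D$. If $(\forall x\in 2^{\mathbb{N}})(x\in D\leftrightarrow f(x)\text{ is defined})$, then membership in $D$ is decidable, i.e. there is a functional $\Phi^2$ such that $(\forall x\in 2^{\mathbb{N}})(x\in D\leftrightarrow \Phi(x)=0)$.
   Context: $\mathsf{RCA}_0^\omega$ is Kohlenbach's base theory of higher-order Reverse Mathematics in the language of all finite types: ordered-semiring axioms for $0,1,<,+,\times$, combinators for $\lambda$-abstraction, the primitive recursor $\mathbf{R}_0$, extensionality at all types, quantifier-free induction, and $\mathsf{QF\text{-}AC}^{1,0}$. $2^{\mathbb{N}}$ is Cantor space (binary sequences) with its usual complete separable metric. An RM-closed set $D\subseteq2^{\mathbb{N}}$ is the complement of an RM-open set, the latter coded by a sequence of basic open sets (finite binary strings $\sigma_n$, or rational balls), so that $x\in D$ iff $x$ lies in none of the coded basic open sets (a $\Pi^0_1$ condition). An RM-code of a partial continuous function between complete separable metric spaces $\hat A,\hat B$ (Simpson, Def. II.6.1) is a set $\Phi$ of quintuples $(n,a,r,b,s)$ with $a,b$ points of the countable dense sets and $r,s\in\mathbb{Q}^+$, writing $(a,r)\Phi(b,s)$ if some $(n,a,r,b,s)\in\Phi$, satisfying: $(a,r)\Phi(b,s)\wedge(a,r)\Phi(b',s')\to d(b,b')\le s+s'$; $(a,r)\Phi(b,s)\wedge d(a,a')+r'<r\to(a',r')\Phi(b,s)$;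 $(a,r)\Phi(b,s)\wedge d(b,b')+s<s'\to(a,r)\Phi(b',s')$. It is defined at $x$ iff for every $\varepsilon>0$ there is $(a,r)\Phi(b,s)$ with $d(x,a)<r$ and $s<\varepsilon$ (a $\Sigma^0_1$-type condition for discrete codomain $\mathbb{N}$).
   Formalization: "f(x) is defined" is taken in the Σ⁰₁ form for codomain ℕ: some (a,r)Φ(b,s) with d(x,a)<r and s<1/2, instead of s<ε for every ε>0; under the latter every closed set, e.g. {000…}, is the exact domain of some code and the claim fails. *)

theory Defs
  imports Main
begin

section \<open>Language of all finite types\<close>

datatype ty = TNat ("\<iota>") | Fun ty ty (infixr "\<rightarrow>" 65)

text \<open>\<open>CRec\<close> is the recursor \<open>R\<^sub>0\<close>, with argument order \<open>R\<^sub>0 f m n\<close>.\<close>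

datatype const = CZero | COne | CPlus | CTimes | CK ty ty | CS ty ty ty | CRec

fun const_ty :: "const \<Rightarrow> ty" where
  "const_ty CZero = \<iota>"
| "const_ty COne = \<iota>"
| "const_ty CPlus = \<iota> \<rightarrow> \<iota> \<rightarrow> \<iota>"
| "const_ty CTimes = \<iota> \<rightarrow> \<iota> \<rightarrow> \<iota>"
| "const_ty (CK \<sigma> \<tau>) = \<sigma> \<rightarrow> \<tau> \<rightarrow> \<sigma>"
| "const_ty (CS \<rho> \<sigma> \<tau>) = (\<rho> \<rightarrow> \<sigma> \<rightarrow> \<tau>) \<rightarrow> (\<rho> \<rightarrow> \<sigma>) \<rightarrow> \<rho> \<rightarrow> \<tau>"
| "const_ty CRec = (\<iota> \<rightarrow> \<iota> \<rightarrow> \<iota>) \<rightarrow> \<iota> \<rightarrow> \<iota> \<rightarrow> \<iota>"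

text \<open>A variable is a name together with a type, so equal names at different types are
  different variables.\<close>

datatype tm = Var string ty | Con const | App tm tm (infixl "\<cdot>" 90)

text \<open>\<open>ty_of\<close> is meaningful on well-typed terms only.\<close>

fun ty_of :: "tm \<Rightarrow> ty" where
  "ty_of (Var x \<sigma>) = \<sigma>"
| "ty_of (Con c) = const_ty c"
| "ty_of (s \<cdot> t) = (case ty_of s of \<iota> \<Rightarrow> \<iota> | \<sigma> \<rightarrow> \<tau> \<Rightarrow> \<tau>)"

fun wt :: "tm \<Rightarrow> bool" where
  "wt (Var x \<sigma>) = True"
| "wt (Con c) = True"
| "wt (s \<cdot> t) = (wt s \<and> wt t \<and> ty_of s = ty_of t \<rightarrow> ty_of (s \<cdot> t))"

text \<open>The prime formulas are \<open>=\<^sub>0\<close> and \<open><\<^sub>0\<close>; equality at higher types is defined below.\<close>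

datatype fm =
    Eq tm tm (infix "\<^bold>=" 50)
  | Less tm tm (infix "\<^bold><" 50)
  | Fls
  | Imp fm fm (infixr "\<^bold>\<longrightarrow>" 25)
  | All string ty fm

abbreviation Neg :: "fm \<Rightarrow> fm" ("\<^bold>\<not> _" [40] 40) where
  "\<^bold>\<not> A \<equiv> A \<^bold>\<longrightarrow> Fls"
abbreviation Or :: "fm \<Rightarrow> fm \<Rightarrow> fm" (infixr "\<^bold>\<or>" 30) where
  "A \<^bold>\<or> B \<equiv> \<^bold>\<not> A \<^bold>\<longrightarrow> B"
abbreviation And :: "fm \<Rightarrow> fm \<Rightarrow> fm" (infixr "\<^bold>\<and>" 35) where
  "A \<^bold>\<and> B \<equiv> \<^bold>\<not> (A \<^bold>\<longrightarrow> \<^bold>\<not> B)"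
abbreviation Iff :: "fm \<Rightarrow> fm \<Rightarrow> fm" (infix "\<^bold>\<longleftrightarrow>" 25) where
  "A \<^bold>\<longleftrightarrow> B \<equiv> (A \<^bold>\<longrightarrow> B) \<^bold>\<and> (B \<^bold>\<longrightarrow> A)"
abbreviation Ex :: "string \<Rightarrow> ty \<Rightarrow> fm \<Rightarrow> fm" where
  "Ex x \<sigma> A \<equiv> \<^bold>\<not> All x \<sigma> (\<^bold>\<not> A)"

definition Alls :: "string list \<Rightarrow> fm \<Rightarrow> fm" where
  "Alls xs A = foldr (\<lambda>x. All x \<iota>) xs A"
definition Exs :: "string list \<Rightarrow> fm \<Rightarrow> fm" where
  "Exs xs A = foldr (\<lambda>x. Ex x \<iota>) xs A"

fun wf_fm :: "fm \<Rightarrow> bool" where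
  "wf_fm (s \<^bold>= t) = (wt s \<and> ty_of s = \<iota> \<and> wt t \<and> ty_of t = \<iota>)"
| "wf_fm (s \<^bold>< t) = (wt s \<and> ty_of s = \<iota> \<and> wt t \<and> ty_of t = \<iota>)"
| "wf_fm Fls = True"
| "wf_fm (A \<^bold>\<longrightarrow> B) = (wf_fm A \<and> wf_fm B)"
| "wf_fm (All x \<sigma> A) = wf_fm A"

fun qf :: "fm \<Rightarrow> bool" where
  "qf (s \<^bold>= t) = True"
| "qf (s \<^bold>< t) = True"
| "qf Fls = True"
| "qf (A \<^bold>\<longrightarrow> B) = (qf A \<and> qf B)"
| "qf (All x \<sigma> A) = False"

fun fv_tm :: "tm \<Rightarrow> (string \<times> ty) set" where
  "fv_tm (Var x \<sigma>) = {(x, \<sigma>)}"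
| "fv_tm (Con c) = {}"
| "fv_tm (s \<cdot> t) = fv_tm s \<union> fv_tm t"

fun fv :: "fm \<Rightarrow> (string \<times> ty) set" where
  "fv (s \<^bold>= t) = fv_tm s \<union> fv_tm t"
| "fv (s \<^bold>< t) = fv_tm s \<union> fv_tm t"
| "fv Fls = {}"
| "fv (A \<^bold>\<longrightarrow> B) = fv A \<union> fv B"
| "fv (All x \<sigma> A) = fv A - {(x, \<sigma>)}"

text \<open>Substitution does not rename bound variables; its uses carry the side condition
  \<open>free_for\<close>, which excludes capture.\<close>

fun subst_tm :: "string \<times> ty \<Rightarrow> tm \<Rightarrow> tm \<Rightarrow> tm" where
  "subst_tm v u (Var x \<sigma>) = (if (x, \<sigma>) = v then u else Var x \<sigma>)"
| "subst_tm v u (Con c) = Con c"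
| "subst_tm v u (s \<cdot> t) = subst_tm v u s \<cdot> subst_tm v u t"

fun subst :: "string \<times> ty \<Rightarrow> tm \<Rightarrow> fm \<Rightarrow> fm" where
  "subst v u (s \<^bold>= t) = (subst_tm v u s \<^bold>= subst_tm v u t)"
| "subst v u (s \<^bold>< t) = (subst_tm v u s \<^bold>< subst_tm v u t)"
| "subst v u Fls = Fls"
| "subst v u (A \<^bold>\<longrightarrow> B) = (subst v u A \<^bold>\<longrightarrow> subst v u B)"
| "subst v u (All x \<sigma> A) = (if (x, \<sigma>) = v then All x \<sigma> A else All x \<sigma> (subst v u A))"

fun free_for :: "tm \<Rightarrow> string \<times> ty \<Rightarrow> fm \<Rightarrow> bool" where
  "free_for u v (s \<^bold>= t) = True"
| "free_for u v (s \<^bold>< t) = True"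
| "free_for u v Fls = True"
| "free_for u v (A \<^bold>\<longrightarrow> B) = (free_for u v A \<and> free_for u v B)"
| "free_for u v (All x \<sigma> A) =
     (v \<notin> fv (All x \<sigma> A) \<or> ((x, \<sigma>) \<notin> fv_tm u \<and> free_for u v A))"


section \<open>Classical many-sorted first-order logic with equality at type 0\<close>

text \<open>Natural deduction from a set \<open>T\<close> of axioms and a context \<open>\<Gamma>\<close> of assumptions. Axioms are
  read as universally closed, so the eigenvariable condition concerns \<open>\<Gamma>\<close> only.\<close>

inductive deriv :: "fm set \<Rightarrow> fm set \<Rightarrow> fm \<Rightarrow> bool" for T :: "fm set" where
  Ax: "A \<in> T \<Longrightarrow> deriv T \<Gamma> A"
| Hyp: "A \<in> \<Gamma> \<Longrightarrow> wf_fm A \<Longrightarrow> deriv T \<Gamma> A"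
| ImpI: "deriv T (insert A \<Gamma>) B \<Longrightarrow> wf_fm A \<Longrightarrow> deriv T \<Gamma> (A \<^bold>\<longrightarrow> B)"
| ImpE: "deriv T \<Gamma> (A \<^bold>\<longrightarrow> B) \<Longrightarrow> deriv T \<Gamma> A \<Longrightarrow> deriv T \<Gamma> B"
| Contr: "deriv T (insert (\<^bold>\<not> A) \<Gamma>) Fls \<Longrightarrow> wf_fm A \<Longrightarrow> deriv T \<Gamma> A"
| AllI: "deriv T \<Gamma> A \<Longrightarrow> \<forall>B\<in>\<Gamma>. (x, \<sigma>) \<notin> fv B \<Longrightarrow> deriv T \<Gamma> (All x \<sigma> A)"
| AllE: "deriv T \<Gamma> (All x \<sigma> A) \<Longrightarrow> wt t \<Longrightarrow> ty_of t = \<sigma> \<Longrightarrow> free_for t (x, \<sigma>) A \<Longrightarrow>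
     deriv T \<Gamma> (subst (x, \<sigma>) t A)"
| EqRefl: "wt t \<Longrightarrow> ty_of t = \<iota> \<Longrightarrow> deriv T \<Gamma> (t \<^bold>= t)"
| EqSubst: "deriv T \<Gamma> (s \<^bold>= t) \<Longrightarrow> deriv T \<Gamma> (subst (x, \<iota>) s A) \<Longrightarrow> wf_fm A \<Longrightarrow>
     free_for s (x, \<iota>) A \<Longrightarrow> free_for t (x, \<iota>) A \<Longrightarrow> deriv T \<Gamma> (subst (x, \<iota>) t A)"

abbreviation provable :: "fm set \<Rightarrow> fm \<Rightarrow> bool" (infix "\<turnstile>" 20) where
  "T \<turnstile> A \<equiv> deriv T {} A"


section \<open>The theory $\mathsf{RCA}_0^\omega$\<close>

abbreviation v0 :: "string \<Rightarrow> tm" where "v0 x \<equiv> Var x \<iota>"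
abbreviation v1 :: "string \<Rightarrow> tm" where "v1 x \<equiv> Var x (\<iota> \<rightarrow> \<iota>)"
abbreviation v2 :: "string \<Rightarrow> tm" where "v2 x \<equiv> Var x ((\<iota> \<rightarrow> \<iota>) \<rightarrow> \<iota>)"

abbreviation zero :: tm ("\<^bold>0") where "\<^bold>0 \<equiv> Con CZero"
abbreviation one :: tm ("\<^bold>1") where "\<^bold>1 \<equiv> Con COne"
abbreviation plus_tm :: "tm \<Rightarrow> tm \<Rightarrow> tm" (infixl "\<oplus>" 65) where
  "s \<oplus> t \<equiv> Con CPlus \<cdot> s \<cdot> t"
abbreviation times_tm :: "tm \<Rightarrow> tm \<Rightarrow> tm" (infixl "\<otimes>" 70) where
  "s \<otimes> t \<equiv> Con CTimes \<cdot> s \<cdot> t"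
abbreviation Leq :: "tm \<Rightarrow> tm \<Rightarrow> fm" (infix "\<^bold>\<le>" 50) where
  "s \<^bold>\<le> t \<equiv> s \<^bold>< t \<^bold>\<or> s \<^bold>= t"

text \<open>Extensional equality \<open>s =\<^sub>\<rho> t\<close>. The bound variables are named \<open>z\<close>, \<open>zz\<close>, ..., with
  distinct names along one type; \<open>s\<close> and \<open>t\<close> must not contain variables with such names.\<close>

fun arity :: "ty \<Rightarrow> nat" where
  "arity \<iota> = 0"
| "arity (\<sigma> \<rightarrow> \<tau>) = Suc (arity \<tau>)"

fun eqt :: "ty \<Rightarrow> tm \<Rightarrow> tm \<Rightarrow> fm" where
  "eqt \<iota> s t = (s \<^bold>= t)"
| "eqt (\<sigma> \<rightarrow> \<tau>) s t =
     (let z = replicate (Suc (arity \<tau>)) (CHR ''z'')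
      in All z \<sigma> (eqt \<tau> (s \<cdot> Var z \<sigma>) (t \<cdot> Var z \<sigma>)))"

text \<open>The axioms of a discretely ordered commutative semiring.\<close>

definition arith_axioms :: "fm set" where
  "arith_axioms = (let x = v0 ''x''; y = v0 ''y''; z = v0 ''z'' in
    { x \<oplus> y \<^bold>= y \<oplus> x,
      (x \<oplus> y) \<oplus> z \<^bold>= x \<oplus> (y \<oplus> z),
      x \<oplus> \<^bold>0 \<^bold>= x,
      x \<otimes> y \<^bold>= y \<otimes> x,
      (x \<otimes> y) \<otimes> z \<^bold>= x \<otimes> (y \<otimes> z),
      x \<otimes> \<^bold>1 \<^bold>= x,
      x \<otimes> \<^bold>0 \<^bold>= \<^bold>0,
      x \<otimes> (y \<oplus> z) \<^bold>= x \<otimes> y \<oplus> x \<otimes> z,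
      \<^bold>\<not> x \<^bold>< x,
      x \<^bold>< y \<^bold>\<longrightarrow> y \<^bold>< z \<^bold>\<longrightarrow> x \<^bold>< z,
      x \<^bold>< y \<^bold>\<or> x \<^bold>= y \<^bold>\<or> y \<^bold>< x,
      x \<^bold>< y \<^bold>\<longrightarrow> x \<oplus> z \<^bold>< y \<oplus> z,
      x \<^bold>< y \<^bold>\<longrightarrow> \<^bold>0 \<^bold>< z \<^bold>\<longrightarrow> x \<otimes> z \<^bold>< y \<otimes> z,
      \<^bold>0 \<^bold>< \<^bold>1,
      \<^bold>0 \<^bold>\<le> x,
      x \<^bold>< y \<^bold>\<longrightarrow> x \<oplus> \<^bold>1 \<^bold>\<le> y })"

inductive_set RCA0\<omega> :: "fm set" where
  Arith: "A \<in> arith_axioms \<Longrightarrow> A \<in> RCA0\<omega>"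
| AxK: "eqt \<rho> (Con (CK \<rho> \<tau>) \<cdot> Var ''x'' \<rho> \<cdot> Var ''y'' \<tau>) (Var ''x'' \<rho>) \<in> RCA0\<omega>"
| AxS: "x = Var ''x'' (\<rho> \<rightarrow> \<sigma> \<rightarrow> \<tau>) \<Longrightarrow> y = Var ''y'' (\<rho> \<rightarrow> \<sigma>) \<Longrightarrow> w = Var ''w'' \<rho> \<Longrightarrow>
     eqt \<tau> (Con (CS \<rho> \<sigma> \<tau>) \<cdot> x \<cdot> y \<cdot> w) (x \<cdot> w \<cdot> (y \<cdot> w)) \<in> RCA0\<omega>"
| Rec0: "f = Var ''f'' (\<iota> \<rightarrow> \<iota> \<rightarrow> \<iota>) \<Longrightarrow>
     (Con CRec \<cdot> f \<cdot> v0 ''m'' \<cdot> \<^bold>0 \<^bold>= v0 ''m'') \<in> RCA0\<omega>"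
| RecS: "f = Var ''f'' (\<iota> \<rightarrow> \<iota> \<rightarrow> \<iota>) \<Longrightarrow>
     (Con CRec \<cdot> f \<cdot> v0 ''m'' \<cdot> (v0 ''n'' \<oplus> \<^bold>1)
        \<^bold>= f \<cdot> v0 ''n'' \<cdot> (Con CRec \<cdot> f \<cdot> v0 ''m'' \<cdot> v0 ''n'')) \<in> RCA0\<omega>"
| Ext: "x = Var ''x'' \<rho> \<Longrightarrow> y = Var ''y'' \<rho> \<Longrightarrow> f = Var ''f'' (\<rho> \<rightarrow> \<tau>) \<Longrightarrow>
     (eqt \<rho> x y \<^bold>\<longrightarrow> eqt \<tau> (f \<cdot> x) (f \<cdot> y)) \<in> RCA0\<omega>"
| QFInd: "qf A \<Longrightarrow> wf_fm A \<Longrightarrow>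
     (subst (n, \<iota>) \<^bold>0 A \<^bold>\<and> All n \<iota> (A \<^bold>\<longrightarrow> subst (n, \<iota>) (v0 n \<oplus> \<^bold>1) A) \<^bold>\<longrightarrow> All n \<iota> A) \<in> RCA0\<omega>"
| QFAC10: "qf A \<Longrightarrow> wf_fm A \<Longrightarrow> (Y, (\<iota> \<rightarrow> \<iota>) \<rightarrow> \<iota>) \<notin> fv A \<Longrightarrow>
     (All x (\<iota> \<rightarrow> \<iota>) (Ex y \<iota> A) \<^bold>\<longrightarrow>
      Ex Y ((\<iota> \<rightarrow> \<iota>) \<rightarrow> \<iota>) (All x (\<iota> \<rightarrow> \<iota>) (subst (y, \<iota>) (v2 Y \<cdot> v1 x) A))) \<in> RCA0\<omega>"


section \<open>Coding of Cantor space and of continuous partial functions\<close>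

text \<open>\<open>\<lambda>\<close>-abstraction by the combinators.\<close>

fun lam :: "string \<Rightarrow> ty \<Rightarrow> tm \<Rightarrow> tm" where
  "lam x \<sigma> (Var y \<tau>) =
     (if (y, \<tau>) = (x, \<sigma>) then Con (CS \<sigma> (\<sigma> \<rightarrow> \<sigma>) \<sigma>) \<cdot> Con (CK \<sigma> (\<sigma> \<rightarrow> \<sigma>)) \<cdot> Con (CK \<sigma> \<sigma>)
      else Con (CK \<tau> \<sigma>) \<cdot> Var y \<tau>)"
| "lam x \<sigma> (Con c) = Con (CK (const_ty c) \<sigma>) \<cdot> Con c"
| "lam x \<sigma> (s \<cdot> t) = Con (CS \<sigma> (ty_of t) (ty_of (s \<cdot> t))) \<cdot> lam x \<sigma> s \<cdot> lam x \<sigma> t"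

text \<open>Closed term for \<open>n \<mapsto> 2\<^sup>n\<close>.\<close>

definition pow2 :: tm where
  "pow2 = Con CRec \<cdot> lam ''i'' \<iota> (lam ''r'' \<iota> (v0 ''r'' \<oplus> v0 ''r'')) \<cdot> \<^bold>1"

text \<open>A finite binary string \<open>\<sigma>\<close> is coded by the number with binary expansion \<open>1\<sigma>\<close>, and
  \<open>initseg \<cdot> x \<cdot> k\<close> is the code of \<open>(x(0), ..., x(k-1))\<close> for binary \<open>x\<close>. The number 0 is not
  the code of a string.\<close>

definition initseg :: tm where
  "initseg = lam ''x'' (\<iota> \<rightarrow> \<iota>)
     (Con CRec \<cdot> lam ''i'' \<iota> (lam ''r'' \<iota> ((v0 ''r'' \<oplus> v0 ''r'') \<oplus> v1 ''x'' \<cdot> v0 ''i'')) \<cdot> \<^bold>1)"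

text \<open>The countable dense subset of Cantor space consists of the eventually vanishing binary
  sequences: the number \<open>a\<close> stands for the point \<open>dpt \<cdot> a\<close> whose \<open>i\<close>-th entry is
  the coefficient of \<open>2\<^sup>i\<close> in the binary expansion of \<open>a\<close>. Below, \<open>iszero\<close> is the characteristic
  function with \<open>iszero(0) = 1\<close>, and \<open>parity\<close> and \<open>half\<close> are \<open>n mod 2\<close> and \<open>n div 2\<close>.\<close>

definition iszero :: tm where
  "iszero = Con CRec \<cdot> lam ''i'' \<iota> (lam ''r'' \<iota> \<^bold>0) \<cdot> \<^bold>1"
definition parity :: tm where
  "parity = Con CRec \<cdot> lam ''i'' \<iota> (lam ''r'' \<iota> (iszero \<cdot> v0 ''r'')) \<cdot> \<^bold>0"
definition half :: tm where
  "half = Con CRec \<cdot> lam ''i'' \<iota> (lam ''r'' \<iota> (v0 ''r'' \<oplus> parity \<cdot> v0 ''i'')) \<cdot> \<^bold>0"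
definition dpt :: tm where
  "dpt = lam ''a'' \<iota> (lam ''i'' \<iota>
     (parity \<cdot> (Con CRec \<cdot> lam ''j'' \<iota> (lam ''r'' \<iota> (half \<cdot> v0 ''r'')) \<cdot> v0 ''a'' \<cdot> v0 ''i'')))"

text \<open>In the following formulas, the arguments must not contain the variables bound by them:
  \<open>k\<close>, \<open>l\<close> of type 0 in \<open>in_cantor\<close>, \<open>in_closed\<close> and \<open>d_add_less\<close>, and the variables listed in the
  quantifier prefix otherwise. Throughout, a pair of positive numbers \<open>p\<close>, \<open>q\<close> stands for the
  rational \<open>p/q\<close>.\<close>

definition in_cantor :: "tm \<Rightarrow> fm" where
  "in_cantor x = All ''k'' \<iota> (x \<cdot> v0 ''k'' \<^bold>< \<^bold>1 \<oplus> \<^bold>1)"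

text \<open>\<open>D\<close> codes the closed set which is the complement of the union of the basic open sets
  \<open>[D(l)]\<close>; an entry \<open>D(l) = 0\<close> contributes nothing, so that the empty union is allowed.\<close>

definition in_closed :: "tm \<Rightarrow> tm \<Rightarrow> fm" where
  "in_closed x D = All ''l'' \<iota> (\<^bold>\<not> Ex ''k'' \<iota> (initseg \<cdot> x \<cdot> v0 ''k'' \<^bold>= D \<cdot> v0 ''l''))"

text \<open>\<open>d(x,y) + p'/q' < p/q\<close> in Cantor space, where
  \<open>d(x,y) = inf {2\<^sup>-\<^sup>k | (x(0), ..., x(k-1)) = (y(0), ..., y(k-1))}\<close>; the denominators
  have been cleared in \<open>2\<^sup>-\<^sup>k + p'/q' < p/q\<close>.\<close>

definition d_add_less :: "tm \<Rightarrow> tm \<Rightarrow> tm \<Rightarrow> tm \<Rightarrow> tm \<Rightarrow> tm \<Rightarrow> fm" where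
  "d_add_less x y p' q' p q =
     Ex ''k'' \<iota> (initseg \<cdot> x \<cdot> v0 ''k'' \<^bold>= initseg \<cdot> y \<cdot> v0 ''k'' \<^bold>\<and>
       (q' \<oplus> p' \<otimes> (pow2 \<cdot> v0 ''k'')) \<otimes> q \<^bold>< p \<otimes> q' \<otimes> (pow2 \<cdot> v0 ''k''))"

definition d_less :: "tm \<Rightarrow> tm \<Rightarrow> tm \<Rightarrow> tm \<Rightarrow> fm" where
  "d_less x y p q = d_add_less x y \<^bold>0 \<^bold>1 p q"

text \<open>The space \<open>\<nat>\<close> carries \<open>d(b,b') = |b - b'|\<close>: the formulas express
  \<open>d(b,b') \<le> u/v + u'/v'\<close> and \<open>d(b,b') + u/v < u'/v'\<close>.\<close>

definition dN_le_add :: "tm \<Rightarrow> tm \<Rightarrow> tm \<Rightarrow> tm \<Rightarrow> tm \<Rightarrow> tm \<Rightarrow> fm" where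
  "dN_le_add b b' u v u' v' =
     (b \<otimes> (v \<otimes> v') \<^bold>\<le> b' \<otimes> (v \<otimes> v') \<oplus> (u \<otimes> v' \<oplus> u' \<otimes> v) \<^bold>\<and>
      b' \<otimes> (v \<otimes> v') \<^bold>\<le> b \<otimes> (v \<otimes> v') \<oplus> (u \<otimes> v' \<oplus> u' \<otimes> v))"

definition dN_add_less :: "tm \<Rightarrow> tm \<Rightarrow> tm \<Rightarrow> tm \<Rightarrow> tm \<Rightarrow> tm \<Rightarrow> fm" where
  "dN_add_less b b' u v u' v' =
     (b \<otimes> (v \<otimes> v') \<oplus> u \<otimes> v' \<^bold>< b' \<otimes> (v \<otimes> v') \<oplus> u' \<otimes> v \<^bold>\<and>
      b' \<otimes> (v \<otimes> v') \<oplus> u \<otimes> v' \<^bold>< b \<otimes> (v \<otimes> v') \<oplus> u' \<otimes> v)"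

definition posrat :: "tm \<Rightarrow> tm \<Rightarrow> fm" where
  "posrat p q = (\<^bold>0 \<^bold>< p \<^bold>\<and> \<^bold>0 \<^bold>< q)"

text \<open>The injective pairing of Simpson's book.\<close>

definition pair :: "tm \<Rightarrow> tm \<Rightarrow> tm" where
  "pair s t = (s \<oplus> t) \<otimes> (s \<oplus> t) \<oplus> s"

text \<open>A set of numbers is given by a function of type 1, with value 0 on the elements.
  \<open>rel \<Phi> a p q b u v\<close> is \<open>(a, p/q) \<Phi> (b, u/v)\<close>: some quintuple \<open>(n, a, r, b, s)\<close> with rationals
  \<open>r = p/q\<close> and \<open>s = u/v\<close> has its code in \<open>\<Phi>\<close>. As the fractions in the code need not be reduced,
  the rationals are compared by cross-multiplication.\<close>

definition rel :: "tm \<Rightarrow> tm \<Rightarrow> tm \<Rightarrow> tm \<Rightarrow> tm \<Rightarrow> tm \<Rightarrow> tm \<Rightarrow> fm" where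
  "rel \<Phi> a p q b u v =
     (posrat p q \<^bold>\<and> posrat u v \<^bold>\<and>
      (let n = v0 ''n''; g = v0 ''g''; h = v0 ''h''; i = v0 ''i''; j = v0 ''j'' in
       Exs [''n'', ''g'', ''h'', ''i'', ''j'']
        (posrat g h \<^bold>\<and> posrat i j \<^bold>\<and> g \<otimes> q \<^bold>= p \<otimes> h \<^bold>\<and> i \<otimes> v \<^bold>= u \<otimes> j \<^bold>\<and>
         \<Phi> \<cdot> pair n (pair a (pair (pair g h) (pair b (pair i j)))) \<^bold>= \<^bold>0)))"

text \<open>Codes of continuous partial functions from Cantor space to \<open>\<nat>\<close>.\<close>

definition is_code :: "tm \<Rightarrow> fm" where
  "is_code \<Phi> =
    (let a = v0 ''a''; p = v0 ''p''; q = v0 ''q''; b = v0 ''b''; u = v0 ''u''; v = v0 ''v'';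
         a' = v0 ''a1''; p' = v0 ''p1''; q' = v0 ''q1''; b' = v0 ''b1''; u' = v0 ''u1''; v' = v0 ''v1''
     in
     Alls [''a'', ''p'', ''q'', ''b'', ''u'', ''v'', ''b1'', ''u1'', ''v1'']
       (rel \<Phi> a p q b u v \<^bold>\<and> rel \<Phi> a p q b' u' v' \<^bold>\<longrightarrow> dN_le_add b b' u v u' v') \<^bold>\<and>
     Alls [''a'', ''p'', ''q'', ''b'', ''u'', ''v'', ''a1'', ''p1'', ''q1'']
       (rel \<Phi> a p q b u v \<^bold>\<and> posrat p' q' \<^bold>\<and> d_add_less (dpt \<cdot> a) (dpt \<cdot> a') p' q' p q
          \<^bold>\<longrightarrow> rel \<Phi> a' p' q' b u v) \<^bold>\<and>
     Alls [''a'', ''p'', ''q'', ''b'', ''u'', ''v'', ''b1'', ''u1'', ''v1'']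
       (rel \<Phi> a p q b u v \<^bold>\<and> posrat u' v' \<^bold>\<and> dN_add_less b b' u v u' v'
          \<^bold>\<longrightarrow> rel \<Phi> a p q b' u' v'))"

text \<open>\<open>\<Phi>\<close> is defined at \<open>x\<close>: there is \<open>(a,r) \<Phi> (b,s)\<close> with \<open>d(x,a) < r\<close> and \<open>s < 1/2\<close>. This is
  the \<open>\<Sigma>\<^sup>0\<^sub>1\<close> form of definedness for the discrete codomain \<open>\<nat>\<close>. The general condition, which asks
  for \<open>s < \<epsilon>\<close> for every \<open>\<epsilon> > 0\<close>, is replaced by its instance \<open>\<epsilon> = 1/2\<close>: balls of radius
  below 1/2 are singletons, and by the first clause of \<open>is_code\<close> any two such \<open>(b,s)\<close>, \<open>(b',s')\<close>
  for the same \<open>(a,r)\<close> have \<open>b = b'\<close>, so that (passing to a common smaller ball by the second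
  clause) the value at \<open>x\<close> is determined. With the
  unrestricted condition every closed set, in particular one with a single element, would be the
  exact domain of some code, and the theorem would not be provable.\<close>

definition defined_at :: "tm \<Rightarrow> tm \<Rightarrow> fm" where
  "defined_at \<Phi> x =
    (let a = v0 ''a''; p = v0 ''p''; q = v0 ''q''; b = v0 ''b''; u = v0 ''u''; v = v0 ''v'' in
     Exs [''a'', ''p'', ''q'', ''b'', ''u'', ''v'']
       (rel \<Phi> a p q b u v \<^bold>\<and> d_less x (dpt \<cdot> a) p q \<^bold>\<and> u \<oplus> u \<^bold>< v))"

end

theory Submission
  imports Defs "HOL-Library.Countable"
begin

text \<open>Every binary sequence \<open>x\<close> either lies in \<open>D\<close>, in which case a number witnesses that the code is
  defined at \<open>x\<close>, or meets one of the basic open sets of the complement, which again is witnessed by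
  a number. So \<open>D\<close> and its complement are both \<open>\<Sigma>\<^sup>0\<^sub>1\<close>; \<open>QF-AC\<^sup>1\<^sup>,\<^sup>0\<close> picks
  witnesses \<open>Y(x)\<close>, and a second application turns the question which kind of witness \<open>Y(x)\<close> is into a
  functional. To bring \<open>\<Sigma>\<^sup>0\<^sub>1\<close> formulas with several quantifiers into the form \<open>\<exists>m. C(x,m) = 0\<close> one uses
  bounded search, defined by \<open>R\<^sub>0\<close>.

  The argument is carried out in an arbitrary model of the theory and transferred to a formal derivation
  by a completeness theorem. The model is built from a Henkin set; the extensionality axioms make provable
  extensional equality a congruence, so that the quotient is an extensional type structure.\<close>

text \<open>\<open>QF-AC\<close> ranges over all sequences of type 1, not only over the binary ones,
  so the two alternatives of the overview do not yet make the search total. A third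
  \<open>\<Sigma>\<^sup>0\<^sub>1\<close> alternative, that some value is not below 2, closes the
  gap; on such sequences the resulting functional may take any value.

  Working in a model replaces long formal derivations with combinators by ordinary mathematics, but
  the numbers of the model may be nonstandard. Induction on them is available only through the
  quantifier-free scheme, and every functional must be shown to exist by abstraction, recursion or
  choice inside the model.

  Equality at higher types is only a defined formula. The quotient turns it into identity, so that
  two sequences with equal entries are the same element; this matters because the dependence of a
  valuation on a sequence is an arbitrary function outside the model.

  Blocks of number quantifiers are contracted by bounding all witnesses by one number, and a
  quantified number is carried along as an extra entry of the sequence. No decoding of pairs is
  required inside the model.\<close>

instance ty :: countable by countable_datatype
instance const :: countable by countable_datatype
instance tm :: countable by countable_datatype
instance fm :: countable by countable_datatype

section \<open>Syntax\<close>

text \<open>Substitution does not rename, so capture is excluded wholesale: a term may be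
  substituted as soon as its variables avoid all bound variables of the formula. This condition is
  stable under substitution, unlike \<open>free_for\<close> itself.\<close>

fun bvs :: "fm \<Rightarrow> (string \<times> ty) set" where
  "bvs (s \<^bold>= t) = {}"
| "bvs (s \<^bold>< t) = {}"
| "bvs Fls = {}"
| "bvs (A \<^bold>\<longrightarrow> B) = bvs A \<union> bvs B"
| "bvs (All x \<sigma> A) = insert (x, \<sigma>) (bvs A)"

lemma finite_fv_tm: "finite (fv_tm t)"
  by (induction t) auto

lemma finite_fv: "finite (fv A)"
  by (induction A) (auto simp: finite_fv_tm)

lemma subst_tm_fresh: "v \<notin> fv_tm t \<Longrightarrow> subst_tm v u t = t"
  by (induction t) auto

lemma subst_fresh: "v \<notin> fv A \<Longrightarrow> subst v u A = A"
  by (induction A) (auto simp: subst_tm_fresh)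

lemma subst_tm_self: "subst_tm (x, \<sigma>) (Var x \<sigma>) t = t"
  by (induction t) auto

lemma subst_self: "subst (x, \<sigma>) (Var x \<sigma>) A = A"
  by (induction A) (auto simp: subst_tm_self)

lemma free_for_self: "free_for (Var x \<sigma>) (x, \<sigma>) A"
  by (induction A) auto

lemma ty_of_subst_tm: "ty_of u = snd v \<Longrightarrow> ty_of (subst_tm v u t) = ty_of t"
  by (induction t) auto

lemma wt_subst_tm: "wt u \<Longrightarrow> ty_of u = snd v \<Longrightarrow> wt t \<Longrightarrow> wt (subst_tm v u t)"
  by (induction t) (auto simp: ty_of_subst_tm)

lemma wf_subst: "wt u \<Longrightarrow> ty_of u = snd v \<Longrightarrow> wf_fm A \<Longrightarrow> wf_fm (subst v u A)"
  by (induction A) (auto simp: ty_of_subst_tm wt_subst_tm)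

lemma fv_subst_tm: "fv_tm (subst_tm v u t) \<subseteq> (fv_tm t - {v}) \<union> fv_tm u"
  by (induction t) auto

lemma fv_subst: "fv (subst v u A) \<subseteq> (fv A - {v}) \<union> fv_tm u"
proof (induction A)
  case (Eq s t)
  then show ?case using fv_subst_tm[of v u s] fv_subst_tm[of v u t] by auto
next
  case (Less s t)
  then show ?case using fv_subst_tm[of v u s] fv_subst_tm[of v u t] by auto
qed auto

lemma bvs_subst [simp]: "bvs (subst v u A) = bvs A"
  by (induction A) auto

lemma free_for_disjoint: "bvs A \<inter> fv_tm u = {} \<Longrightarrow> free_for u v A"
  by (induction A) auto

lemma subst_tm_back:
  "(h, \<sigma>) \<notin> fv_tm t \<Longrightarrow> subst_tm (h, \<sigma>) (Var x \<sigma>) (subst_tm (x, \<sigma>) (Var h \<sigma>) t) = t"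
  by (induction t) auto

text \<open>Needed when a Henkin variable that served as an eigenvariable is turned back into the
  quantified variable. The variable \<open>h\<close> must not be bound in \<open>A\<close> either,
  for otherwise an inner quantifier would block the way back.\<close>

lemma subst_back:
  "(h, \<sigma>) \<notin> fv A \<Longrightarrow> (h, \<sigma>) \<notin> bvs A \<Longrightarrow>
     subst (h, \<sigma>) (Var x \<sigma>) (subst (x, \<sigma>) (Var h \<sigma>) A) = A"
proof (induction A)
  case (All y \<tau> A)
  then show ?case by (cases "(h, \<sigma>) \<in> fv A") (auto simp: subst_fresh)
qed (auto simp: subst_tm_back)

lemma free_for_back:
  "(h, \<sigma>) \<notin> fv A \<Longrightarrow> (h, \<sigma>) \<notin> bvs A \<Longrightarrow>
     free_for (Var x \<sigma>) (h, \<sigma>) (subst (x, \<sigma>) (Var h \<sigma>) A)"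
proof (induction A)
  case (All y \<tau> A)
  then show ?case by (cases "(h, \<sigma>) \<in> fv A") (auto simp: free_for_disjoint)
qed auto

lemma wf_foldr_Imp: "wf_fm (foldr Imp L A) \<longleftrightarrow> (\<forall>B\<in>set L. wf_fm B) \<and> wf_fm A"
  by (induction L) auto

lemma fv_foldr_Imp: "fv (foldr Imp L A) = (\<Union>B\<in>set L. fv B) \<union> fv A"
  by (induction L) auto


section \<open>Entailment from a set of formulas\<close>

lemma deriv_foldr_ImpI:
  "deriv T (set L \<union> \<Delta>) A \<Longrightarrow> \<forall>B\<in>set L. wf_fm B \<Longrightarrow> deriv T \<Delta> (foldr Imp L A)"
  by (induction L arbitrary: \<Delta>) (auto intro!: ImpI)

lemma deriv_foldr_ImpE:
  "deriv T \<Delta> (foldr Imp L A) \<Longrightarrow> set L \<subseteq> \<Delta> \<Longrightarrow> \<forall>B\<in>set L. wf_fm B \<Longrightarrow> deriv T \<Delta> A"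
  by (induction L) (simp, metis ImpE Hyp foldr_Cons comp_apply insert_subset list.simps(15) insert_iff)

text \<open>\<open>deriv\<close> has no evident weakening property, because of its eigenvariable condition. Moving the
  assumptions into the formula makes weakening a matter of propositional logic.\<close>

definition entails :: "fm set \<Rightarrow> fm set \<Rightarrow> fm \<Rightarrow> bool" where
  "entails T \<Gamma> A \<longleftrightarrow> (\<exists>L. set L \<subseteq> \<Gamma> \<and> (T \<turnstile> foldr Imp L A))"

lemma entails_mono: "entails T \<Gamma> A \<Longrightarrow> \<Gamma> \<subseteq> \<Delta> \<Longrightarrow> entails T \<Delta> A"
  unfolding entails_def by blast

lemma entails_provable: "T \<turnstile> A \<Longrightarrow> entails T \<Gamma> A"
  unfolding entails_def by (rule exI[of _ "[]"]) simp

lemma entails_hyp: "A \<in> \<Gamma> \<Longrightarrow> wf_fm A \<Longrightarrow> entails T \<Gamma> A"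
  unfolding entails_def by (rule exI[of _ "[A]"]) (auto intro: ImpI Hyp)

lemma entails_mp:
  assumes wf: "\<forall>C\<in>\<Gamma>. wf_fm C" "wf_fm A" "wf_fm B"
    and "entails T \<Gamma> (A \<^bold>\<longrightarrow> B)" "entails T \<Gamma> A"
  shows "entails T \<Gamma> B"
proof -
  obtain L1 L2 where L: "set L1 \<subseteq> \<Gamma>" "set L2 \<subseteq> \<Gamma>"
    and d: "T \<turnstile> foldr Imp L1 (A \<^bold>\<longrightarrow> B)" "T \<turnstile> foldr Imp L2 A"
    using assms(4,5) unfolding entails_def by blast
  let ?f1 = "foldr Imp L1 (A \<^bold>\<longrightarrow> B)" and ?f2 = "foldr Imp L2 A"
  have w: "wf_fm ?f1" "wf_fm ?f2" "\<forall>C\<in>set (L1 @ L2). wf_fm C"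
    using L wf by (auto simp: wf_foldr_Imp)
  \<comment> \<open>Both provable implications enter the context as assumptions and are discharged
    again against their proofs from the empty context. This takes the place of weakening.\<close>
  let ?D = "set (L1 @ L2) \<union> {?f1, ?f2}"
  have "deriv T ?D (A \<^bold>\<longrightarrow> B)"
    by (rule deriv_foldr_ImpE[of _ _ L1]) (use w in \<open>auto intro: Hyp\<close>)
  moreover have "deriv T ?D A"
    by (rule deriv_foldr_ImpE[of _ _ L2]) (use w in \<open>auto intro: Hyp\<close>)
  ultimately have "deriv T ?D B" by (rule ImpE)
  then have "deriv T {?f1, ?f2} (foldr Imp (L1 @ L2) B)"
    using w(3) by (rule deriv_foldr_ImpI)
  then have "T \<turnstile> ?f2 \<^bold>\<longrightarrow> ?f1 \<^bold>\<longrightarrow> foldr Imp (L1 @ L2) B"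
    using w by (auto intro!: ImpI)
  then have "T \<turnstile> foldr Imp (L1 @ L2) B"
    using d by (blast intro: ImpE)
  then show ?thesis
    unfolding entails_def using L by (intro exI[of _ "L1 @ L2"]) auto
qed

text \<open>The bridge from \<open>deriv\<close> to \<open>entails\<close>: a propositional step is
  derived once from a finite list and then transferred to any set that entails the members of the
  list.\<close>

lemma entails_cut:
  assumes "\<forall>C\<in>\<Gamma>. wf_fm C" "\<forall>C\<in>set L. wf_fm C \<and> entails T \<Gamma> C" "wf_fm A" "deriv T (set L) A"
  shows "entails T \<Gamma> A"
proof -
  have "entails T \<Gamma> (foldr Imp L A)"
    using deriv_foldr_ImpI[of T L "{}" A] assms by (auto intro: entails_provable)
  with assms(2) show ?thesis
  proof (induction L)
    case (Cons B L)
    have "entails T \<Gamma> (foldr Imp L A)"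
      by (rule entails_mp[of \<Gamma> B "foldr Imp L A"])
        (use Cons.prems assms(1,3) in \<open>simp_all add: wf_foldr_Imp\<close>)
    with Cons show ?case by simp
  qed simp
qed

lemma entails_ImpI:
  assumes wf: "\<forall>C\<in>\<Gamma>. wf_fm C" "wf_fm A" "wf_fm B" and "entails T (insert A \<Gamma>) B"
  shows "entails T \<Gamma> (A \<^bold>\<longrightarrow> B)"
proof -
  obtain L where L: "set L \<subseteq> insert A \<Gamma>" and d: "T \<turnstile> foldr Imp L B"
    using assms(4) unfolding entails_def by blast
  \<comment> \<open>The formula \<open>A\<close> may occur several times in \<open>L\<close>; as
    contexts are sets, a single \<open>ImpI\<close> discharges all occurrences.\<close>
  let ?L = "filter (\<lambda>C. C \<noteq> A) L" and ?f = "foldr Imp L B"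
  have w: "wf_fm ?f" "\<forall>C\<in>set L. wf_fm C" using L wf by (auto simp: wf_foldr_Imp)
  have "deriv T (insert A (set ?L \<union> {?f})) B"
    by (rule deriv_foldr_ImpE[of _ _ L]) (use w L in \<open>auto intro: Hyp\<close>)
  then have "deriv T (set ?L \<union> {?f}) (A \<^bold>\<longrightarrow> B)"
    using wf(2) by (rule ImpI)
  then have "deriv T {?f} (foldr Imp ?L (A \<^bold>\<longrightarrow> B))"
    using w(2) by (intro deriv_foldr_ImpI) auto
  then have "T \<turnstile> foldr Imp ?L (A \<^bold>\<longrightarrow> B)"
    using w(1) d by (blast intro: ImpI ImpE)
  then show ?thesis
    unfolding entails_def using L by (intro exI[of _ ?L]) auto
qed

lemma entails_Contr:
  assumes "\<forall>C\<in>\<Gamma>. wf_fm C" "wf_fm A" "entails T (insert (\<^bold>\<not> A) \<Gamma>) Fls"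
  shows "entails T \<Gamma> A"
proof (rule entails_cut[OF assms(1), of "[\<^bold>\<not> \<^bold>\<not> A]"])
  show "\<forall>C\<in>set [\<^bold>\<not> \<^bold>\<not> A]. wf_fm C \<and> entails T \<Gamma> C"
    using assms by (auto intro: entails_ImpI)
  show "deriv T (set [\<^bold>\<not> \<^bold>\<not> A]) A"
    by (rule Contr, rule ImpE[of _ _ "\<^bold>\<not> A"]) (use assms in \<open>auto intro: Hyp\<close>)
qed (use assms in auto)


section \<open>Maximal consistent sets\<close>

text \<open>Variables whose name starts with \<open>#\<close> play the role of Henkin constants. They are never bound
  in the formulas below, so that substituting terms over them captures nothing.\<close>

definition hvars :: "(string \<times> ty) set" where
  "hvars = {(CHR ''#'' # s, \<sigma>) | s \<sigma>. True}"

text \<open>With Henkin variables in the role of constants these are the sentences of the extended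
  language, and \<open>hterms\<close> are its closed terms.\<close>

definition good :: "fm \<Rightarrow> bool" where
  "good A \<longleftrightarrow> wf_fm A \<and> fv A \<subseteq> hvars \<and> bvs A \<inter> hvars = {}"

definition hterms :: "ty \<Rightarrow> tm set" where
  "hterms \<sigma> = {t. wt t \<and> ty_of t = \<sigma> \<and> fv_tm t \<subseteq> hvars}"

lemma good_simps [simp]:
  "good Fls"
  "good (A \<^bold>\<longrightarrow> B) \<longleftrightarrow> good A \<and> good B"
  "good (s \<^bold>= t) \<longleftrightarrow> s \<in> hterms \<iota> \<and> t \<in> hterms \<iota>"
  "good (s \<^bold>< t) \<longleftrightarrow> s \<in> hterms \<iota> \<and> t \<in> hterms \<iota>"
  by (auto simp: good_def hterms_def)

lemma good_subst: "good (All x \<sigma> A) \<Longrightarrow> t \<in> hterms \<sigma> \<Longrightarrow> good (subst (x, \<sigma>) t A)"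
  using fv_subst[of "(x, \<sigma>)" t A] by (auto simp: good_def hterms_def wf_subst)

lemma good_free_for: "good (All x \<sigma> A) \<Longrightarrow> t \<in> hterms \<sigma> \<Longrightarrow> free_for t v A"
  by (rule free_for_disjoint) (auto simp: good_def hterms_def)

lemma finite_fresh_hvar:
  assumes "finite V"
  shows "\<exists>h. (h, \<sigma>) \<in> hvars \<and> (h, \<sigma>) \<notin> V"
proof -
  have "infinite (range (\<lambda>n. (CHR ''#'' # replicate n CHR ''#'', \<sigma>)))"
    using finite_imageD[of "\<lambda>n. (CHR ''#'' # replicate n CHR ''#'', \<sigma>)" UNIV] infinite_UNIV_nat
    by (auto simp: inj_on_def)
  then have "\<not> range (\<lambda>n. (CHR ''#'' # replicate n CHR ''#'', \<sigma>)) \<subseteq> V"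
    using assms finite_subset by blast
  then show ?thesis by (auto simp: hvars_def)
qed

text \<open>Generalization on a constant. A sentence of the context never contains \<open>x\<close>
  free, since \<open>x\<close> is not a Henkin variable; hence the eigenvariable can be exchanged
  from \<open>h\<close> to \<open>x\<close> before the final \<open>AllI\<close>.\<close>

lemma entails_AllI_fresh:
  assumes good: "\<forall>C\<in>\<Gamma>. good C" "good (All x \<sigma> A)"
    and h: "(h, \<sigma>) \<in> hvars" "(h, \<sigma>) \<notin> fv A" "\<forall>C\<in>\<Gamma>. (h, \<sigma>) \<notin> fv C"
    and e: "entails T \<Gamma> (subst (x, \<sigma>) (Var h \<sigma>) A)"
  shows "entails T \<Gamma> (All x \<sigma> A)"
proof -
  let ?A = "subst (x, \<sigma>) (Var h \<sigma>) A"
  obtain L where L: "set L \<subseteq> \<Gamma>" and d: "T \<turnstile> foldr Imp L ?A"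
    using e unfolding entails_def by blast
  \<comment> \<open>The quantifier over \<open>h\<close> is placed before the whole implication,
    where the empty context makes \<open>AllI\<close> applicable. Used as an assumption, this
    formula no longer has \<open>h\<close> free and does not obstruct the generalization over
    \<open>h\<close> in \<open>?D\<close>.\<close>
  let ?f = "All h \<sigma> (foldr Imp L ?A)" and ?D = "set L \<union> {All h \<sigma> (foldr Imp L ?A)}"
  have x: "(x, \<sigma>) \<notin> hvars" and hb: "(h, \<sigma>) \<notin> bvs A"
    using good(2) h(1) by (auto simp: good_def)
  have hx: "(h, \<sigma>) \<noteq> (x, \<sigma>)" using x h(1) by auto
  have w: "\<forall>C\<in>set L. wf_fm C" "wf_fm ?f"
    using good L h by (auto simp: good_def wf_foldr_Imp wf_subst)
  have "deriv T ?D (foldr Imp L ?A)"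
    using AllE[OF Hyp[of ?f ?D], of "Var h \<sigma>"] w(2)
    by (simp add: subst_self free_for_self)
  then have "deriv T ?D ?A"
    by (rule deriv_foldr_ImpE) (use w in auto)
  then have "deriv T ?D (All h \<sigma> ?A)"
    by (rule AllI) (use h(3) L in auto)
  then have "deriv T ?D (subst (h, \<sigma>) (Var x \<sigma>) ?A)"
    by (rule AllE) (use h(2) hb in \<open>auto simp: free_for_back\<close>)
  then have "deriv T ?D A" using h(2) hb by (simp add: subst_back)
  moreover have "\<forall>B\<in>?D. (x, \<sigma>) \<notin> fv B"
    using L good(1) x hx fv_subst[of "(x, \<sigma>)" "Var h \<sigma>" A] by (auto simp: fv_foldr_Imp good_def)
  ultimately have "deriv T ?D (All x \<sigma> A)" by (rule AllI)
  then have "deriv T {?f} (foldr Imp L (All x \<sigma> A))"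
    using w(1) by (rule deriv_foldr_ImpI)
  moreover have "T \<turnstile> ?f" using d by (rule AllI) simp
  ultimately have "T \<turnstile> foldr Imp L (All x \<sigma> A)" using w(2) by (blast intro: ImpI ImpE)
  then show ?thesis unfolding entails_def using L by blast
qed

text \<open>One stage of the construction. A consistent \<open>A\<close> is added at once together
  with its witness; an inconsistent one is merely left out, and its negation enters when its own
  turn comes. Finiteness of the set guarantees a fresh Henkin variable at every stage.\<close>

lemma Henkin_extension:
  assumes G: "finite G" "\<forall>C\<in>G. good C" "\<not> entails T G Fls"
  shows "\<exists>G'. G \<subseteq> G' \<and> finite G' \<and> (\<forall>C\<in>G'. good C) \<and> \<not> entails T G' Fls \<and>
    (good A \<longrightarrow> A \<in> G' \<or> entails T (insert A G) Fls) \<and>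
    (\<forall>x \<sigma> B. A = (\<^bold>\<not> All x \<sigma> B) \<longrightarrow> A \<in> G' \<longrightarrow> (\<exists>t\<in>hterms \<sigma>. (\<^bold>\<not> subst (x, \<sigma>) t B) \<in> G'))"
proof (cases "good A \<and> \<not> entails T (insert A G) Fls")
  case False
  show ?thesis
  proof (cases "A \<in> G")
    case True
    then show ?thesis using False G by (auto simp: insert_absorb)
  next
    case nin: False
    then show ?thesis using False G by (intro exI[of _ G]) auto
  qed
next
  case True
  show ?thesis
  proof (cases "\<exists>x \<sigma> B. A = (\<^bold>\<not> All x \<sigma> B)")
    case False
    then show ?thesis using True G by (intro exI[of _ "insert A G"]) auto
  next
    case ex: True
    then obtain x \<sigma> B where A: "A = (\<^bold>\<not> All x \<sigma> B)" by blast
    obtain h where h: "(h, \<sigma>) \<in> hvars" "(h, \<sigma>) \<notin> fv B \<union> (\<Union>C\<in>insert A G. fv C)"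
      using finite_fresh_hvar[of "fv B \<union> (\<Union>C\<in>insert A G. fv C)" \<sigma>] G(1) finite_fv by auto
    let ?B = "subst (x, \<sigma>) (Var h \<sigma>) B" and ?G = "insert A G"
    have ht: "Var h \<sigma> \<in> hterms \<sigma>" using h by (auto simp: hterms_def)
    have gB: "good (All x \<sigma> B)" and gG: "\<forall>C\<in>?G. good C" using True A G by auto
    have gB': "good ?B" using gB ht by (rule good_subst)
    have wG: "\<forall>C\<in>?G. wf_fm C" using gG by (auto simp: good_def)
    \<comment> \<open>If the witness were refuted, the instance at the fresh \<open>h\<close> would
      be entailed, hence also the universal formula, against the consistency of its negation
      \<open>A\<close>.\<close>
    have "\<not> entails T (insert (\<^bold>\<not> ?B) ?G) Fls"
    proof
      assume "entails T (insert (\<^bold>\<not> ?B) ?G) Fls"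
      then have "entails T ?G ?B"
        by (rule entails_Contr[rotated 2]) (use wG gB' in \<open>auto simp: good_def\<close>)
      then have eB: "entails T ?G (All x \<sigma> B)"
        by (rule entails_AllI_fresh[OF gG gB h(1), rotated 2]) (use h(2) in auto)
      have "entails T ?G (\<^bold>\<not> All x \<sigma> B)"
        by (rule entails_hyp) (use A wG in auto)
      then have "entails T ?G Fls"
        by (rule entails_mp[OF wG, rotated 2]) (use gB eB in \<open>auto simp: good_def\<close>)
      then show False using True by simp
    qed
    then show ?thesis
      using A ht True G gB' by (intro exI[of _ "insert (\<^bold>\<not> ?B) ?G"]) auto
  qed
qed

locale Henkin_set =
  fixes T M :: "fm set"
  assumes M_good: "A \<in> M \<Longrightarrow> good A"
    and M_deriv: "set L \<subseteq> M \<Longrightarrow> deriv T (set L) A \<Longrightarrow> good A \<Longrightarrow> A \<in> M"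
    and M_neg: "good A \<Longrightarrow> (\<^bold>\<not> A) \<in> M \<longleftrightarrow> A \<notin> M"
    and M_witness: "(\<^bold>\<not> All x \<sigma> B) \<in> M \<Longrightarrow> \<exists>t\<in>hterms \<sigma>. (\<^bold>\<not> subst (x, \<sigma>) t B) \<in> M"

lemma ex_Henkin_set:
  assumes A0: "good A\<^sub>0" "\<not> (T \<turnstile> A\<^sub>0)"
  shows "\<exists>M. Henkin_set T M \<and> A\<^sub>0 \<notin> M"
proof -
  let ?P = "\<lambda>G. finite G \<and> (\<forall>C\<in>G. good C) \<and> \<not> entails T G Fls"
  let ?Q = "\<lambda>G A G'. G \<subseteq> G' \<and> ?P G' \<and>
    (good A \<longrightarrow> A \<in> G' \<or> entails T (insert A G) Fls) \<and>
    (\<forall>x \<sigma> B. A = (\<^bold>\<not> All x \<sigma> B) \<longrightarrow> A \<in> G' \<longrightarrow> (\<exists>t\<in>hterms \<sigma>. (\<^bold>\<not> subst (x, \<sigma>) t B) \<in> G'))"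
  have "\<forall>G A. \<exists>G'. ?P G \<longrightarrow> ?Q G A G'"
    using Henkin_extension[of _ T] by simp
  then obtain step where step: "\<And>G A. ?P G \<Longrightarrow> ?Q G A (step G A)"
    by metis
  \<comment> \<open>Formula number \<open>n\<close> is treated at stage \<open>n\<close>, and every
    formula has a number. Starting from the negation of \<open>A\<^sub>0\<close> keeps
    \<open>A\<^sub>0\<close> itself out.\<close>
  define G where "G = rec_nat {\<^bold>\<not> A\<^sub>0} (\<lambda>n G. step G (from_nat n))"
  have G_0: "G 0 = {\<^bold>\<not> A\<^sub>0}" and G_Suc: "\<And>n. G (Suc n) = step (G n) (from_nat n)"
    by (simp_all add: G_def)
  have P: "?P (G n)" for n
  proof (induction n)
    case 0
    have "\<not> entails T {\<^bold>\<not> A\<^sub>0} Fls"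
    proof
      assume "entails T {\<^bold>\<not> A\<^sub>0} Fls"
      then have "entails T {} A\<^sub>0" by (rule entails_Contr[rotated 2]) (use A0 in \<open>auto simp: good_def\<close>)
      then show False using A0(2) by (simp add: entails_def)
    qed
    then show ?case using A0 by (simp add: G_0)
  next
    case (Suc n)
    then show ?case using step[OF Suc, of "from_nat n"] unfolding G_Suc by blast
  qed
  have Q: "?Q (G n) (from_nat n) (G (Suc n))" for n
    unfolding G_Suc by (rule step[OF P])
  define M where "M = (\<Union>n. G n)"
  have mono: "G m \<subseteq> G n" if "m \<le> n" for m n
    using that by (rule lift_Suc_mono_le[of G, rotated]) (use Q in simp)
  \<comment> \<open>An entailment uses finitely many premises, and these already lie in one stage;
    so an inconsistency of the union would appear at some stage.\<close>
  have sub: "\<exists>n. set L \<subseteq> G n" if "set L \<subseteq> M" for L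
    using that
  proof (induction L)
    case (Cons C L)
    then obtain m n where "set L \<subseteq> G n" "C \<in> G m" by (auto simp: M_def)
    then show ?case using mono[of m "max m n"] mono[of n "max m n"]
      by (intro exI[of _ "max m n"]) auto
  qed simp
  have con: "\<not> entails T M Fls"
  proof
    assume "entails T M Fls"
    then obtain L where L: "set L \<subseteq> M" "T \<turnstile> foldr Imp L Fls" unfolding entails_def by blast
    then obtain n where "set L \<subseteq> G n" using sub by blast
    then show False using P[of n] L unfolding entails_def by blast
  qed
  have gM: "\<forall>C\<in>M. good C" using P by (auto simp: M_def)
  then have wM: "\<forall>C\<in>M. wf_fm C" by (auto simp: good_def)
  \<comment> \<open>A sentence is rejected only if it is inconsistent with its stage. An entailed
    sentence that was rejected would therefore make \<open>M\<close> inconsistent.\<close>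
  have MI: "A \<in> M" if g: "good A" and e: "entails T M A" for A
  proof (rule ccontr)
    let ?n = "to_nat A"
    assume "A \<notin> M"
    then have "A \<notin> G (Suc ?n)" by (auto simp: M_def)
    then have "entails T (insert A (G ?n)) Fls" using Q[of ?n] g by auto
    then have "entails T (insert A M) Fls" by (rule entails_mono) (auto simp: M_def)
    then have "entails T M (\<^bold>\<not> A)" using wM g by (auto intro: entails_ImpI simp: good_def)
    then have "entails T M Fls" using e entails_mp[OF wM, of A Fls] g by (auto simp: good_def)
    then show False using con by blast
  qed
  have der: "A \<in> M" if "set L \<subseteq> M" "deriv T (set L) A" "good A" for L A
    using that wM by (intro MI entails_cut[OF wM, of L]) (auto intro!: entails_hyp simp: good_def)
  have neg: "(\<^bold>\<not> A) \<in> M \<longleftrightarrow> A \<notin> M" if g: "good A" for A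
  proof
    assume "(\<^bold>\<not> A) \<in> M"
    then have "entails T M (\<^bold>\<not> A)" using wM by (blast intro: entails_hyp)
    then show "A \<notin> M"
      using con entails_mp[OF wM, of A Fls T] entails_hyp[of A M T] wM by auto
  next
    assume "A \<notin> M"
    then have "\<not> entails T M A" using MI g by blast
    show "(\<^bold>\<not> A) \<in> M"
    proof (rule ccontr)
      let ?n = "to_nat (\<^bold>\<not> A)"
      assume "(\<^bold>\<not> A) \<notin> M"
      then have "(\<^bold>\<not> A) \<notin> G (Suc ?n)" by (auto simp: M_def)
      then have "entails T (insert (\<^bold>\<not> A) (G ?n)) Fls" using Q[of ?n] g by auto
      then have "entails T (insert (\<^bold>\<not> A) M) Fls" by (rule entails_mono) (auto simp: M_def)
      then show False using \<open>\<not> entails T M A\<close> entails_Contr[OF wM, of A] g by (auto simp: good_def)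
    qed
  qed
  have wit: "\<exists>t\<in>hterms \<sigma>. (\<^bold>\<not> subst (x, \<sigma>) t B) \<in> M" if B: "(\<^bold>\<not> All x \<sigma> B) \<in> M" for x \<sigma> B
  proof -
    let ?A = "\<^bold>\<not> All x \<sigma> B" let ?n = "to_nat ?A"
    have "entails T (insert ?A (G ?n)) Fls \<Longrightarrow> entails T M Fls"
      by (rule entails_mono) (use B in \<open>auto simp: M_def\<close>)
    then have "?A \<in> G (Suc ?n)" using Q[of ?n] gM B con by auto
    then obtain t where "t \<in> hterms \<sigma>" "(\<^bold>\<not> subst (x, \<sigma>) t B) \<in> G (Suc ?n)"
      using Q[of ?n] by auto
    then show ?thesis by (auto simp: M_def)
  qed
  have "(\<^bold>\<not> A\<^sub>0) \<in> M" using G_0 by (auto simp: M_def)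
  then have "A\<^sub>0 \<notin> M" using neg A0(1) by blast
  moreover have "Henkin_set T M"
    by unfold_locales (use gM der neg wit in auto)
  ultimately show ?thesis by blast
qed

section \<open>Semantics\<close>

text \<open>All types share one carrier with a total application; typing is imposed only through the
  domains \<open>dm \<sigma>\<close> over which \<open>sat\<close> quantifies.\<close>

fun val :: "(const \<Rightarrow> 'm) \<Rightarrow> ('m \<Rightarrow> 'm \<Rightarrow> 'm) \<Rightarrow> (string \<times> ty \<Rightarrow> 'm) \<Rightarrow> tm \<Rightarrow> 'm" where
  "val con app e (Var x \<sigma>) = e (x, \<sigma>)"
| "val con app e (Con c) = con c"
| "val con app e (s \<cdot> t) = app (val con app e s) (val con app e t)"

fun sat :: "(ty \<Rightarrow> 'm set) \<Rightarrow> (const \<Rightarrow> 'm) \<Rightarrow> ('m \<Rightarrow> 'm \<Rightarrow> 'm) \<Rightarrow> ('m \<Rightarrow> 'm \<Rightarrow> bool) \<Rightarrow>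
    (string \<times> ty \<Rightarrow> 'm) \<Rightarrow> fm \<Rightarrow> bool" where
  "sat dm con app lt e (s \<^bold>= t) \<longleftrightarrow> val con app e s = val con app e t"
| "sat dm con app lt e (s \<^bold>< t) \<longleftrightarrow> lt (val con app e s) (val con app e t)"
| "sat dm con app lt e Fls \<longleftrightarrow> False"
| "sat dm con app lt e (A \<^bold>\<longrightarrow> B) \<longleftrightarrow> (sat dm con app lt e A \<longrightarrow> sat dm con app lt e B)"
| "sat dm con app lt e (All x \<sigma> A) \<longleftrightarrow> (\<forall>a\<in>dm \<sigma>. sat dm con app lt (e((x, \<sigma>) := a)) A)"

lemma val_cong: "(\<And>v. v \<in> fv_tm t \<Longrightarrow> e v = e' v) \<Longrightarrow> val con app e t = val con app e' t"
  by (induction t) simp_all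

lemma sat_cong:
  "(\<And>v. v \<in> fv A \<Longrightarrow> e v = e' v) \<Longrightarrow> sat dm con app lt e A = sat dm con app lt e' A"
proof (induction A arbitrary: e e')
  case (Eq s t)
  then show ?case using val_cong[of s e e' con app] val_cong[of t e e' con app] by simp
next
  case (Less s t)
  then show ?case using val_cong[of s e e' con app] val_cong[of t e e' con app] by simp
next
  case (Imp A B)
  show ?case using Imp.IH(1)[of e e', OF Imp.prems] Imp.IH(2)[of e e', OF Imp.prems] by simp
next
  case (All x \<sigma> A)
  have "sat dm con app lt (e((x, \<sigma>) := a)) A = sat dm con app lt (e'((x, \<sigma>) := a)) A" for a
    using All.prems by (intro All.IH) auto
  then show ?case by simp
qed simp

lemma val_subst: "val con app e (subst_tm v u t) = val con app (e(v := val con app e u)) t"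
  by (induction t) auto

lemma sat_subst_qf:
  "qf A \<Longrightarrow> sat dm con app lt e (subst v u A) = sat dm con app lt (e(v := val con app e u)) A"
  by (induction A) (auto simp: val_subst)

definition valuation :: "(ty \<Rightarrow> 'm set) \<Rightarrow> (string \<times> ty \<Rightarrow> 'm) \<Rightarrow> bool" where
  "valuation dm e \<longleftrightarrow> (\<forall>x \<sigma>. e (x, \<sigma>) \<in> dm \<sigma>)"

lemma valuation_upd [simp]: "valuation dm e \<Longrightarrow> a \<in> dm \<sigma> \<Longrightarrow> valuation dm (e((x, \<sigma>) := a))"
  by (auto simp: valuation_def)

section \<open>The formulas expressing extensional equality\<close>

definition zname :: "nat \<Rightarrow> string" where
  "zname n = replicate (Suc n) (CHR ''z'')"

lemma eqt_Fun: "eqt (\<sigma> \<rightarrow> \<tau>) s t =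
    All (zname (arity \<tau>)) \<sigma> (eqt \<tau> (s \<cdot> Var (zname (arity \<tau>)) \<sigma>) (t \<cdot> Var (zname (arity \<tau>)) \<sigma>))"
  by (simp add: zname_def Let_def)

declare eqt.simps(2) [simp del]

lemma inj_zname [simp]: "zname m = zname n \<longleftrightarrow> m = n"
  by (metis zname_def length_replicate nat.inject)

lemma arith_names_zname [simp]:
  "''x'' \<noteq> zname n" "''y'' \<noteq> zname n" "''f'' \<noteq> zname n" "''w'' \<noteq> zname n"
  "zname n \<noteq> ''x''" "zname n \<noteq> ''y''" "zname n \<noteq> ''f''" "zname n \<noteq> ''w''"
  by (auto simp: zname_def)

lemma subst_eqt:
  "\<forall>n<arity \<sigma>. fst v \<noteq> zname n \<Longrightarrow> subst v u (eqt \<sigma> s t) = eqt \<sigma> (subst_tm v u s) (subst_tm v u t)"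
  by (induction \<sigma> arbitrary: s t) (auto simp: eqt_Fun)

lemma fv_eqt: "fv (eqt \<sigma> s t) \<subseteq> fv_tm s \<union> fv_tm t"
  by (induction \<sigma> arbitrary: s t) (simp, fastforce simp: eqt_Fun)

lemma bvs_eqt: "bvs (eqt \<sigma> s t) \<subseteq> range zname \<times> UNIV"
  by (induction \<sigma> arbitrary: s t) (simp, fastforce simp: eqt_Fun)

lemma wf_eqt: "wt s \<Longrightarrow> wt t \<Longrightarrow> ty_of s = \<sigma> \<Longrightarrow> ty_of t = \<sigma> \<Longrightarrow> wf_fm (eqt \<sigma> s t)"
  by (induction \<sigma> arbitrary: s t) (auto simp: eqt_Fun)


lemma zname_not_hvars [simp]: "(zname n, \<sigma>) \<notin> hvars"
  by (auto simp: zname_def hvars_def)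

lemma name_not_hvars [simp]: "c \<noteq> CHR ''#'' \<Longrightarrow> (c # s, \<sigma>) \<notin> hvars"
  by (auto simp: hvars_def)


section \<open>Simultaneous substitution\<close>

text \<open>The syntactic counterpart of a valuation: in the term model an assignment sends
  variables to closed terms, and truth under it amounts to membership of the substituted formula in
  the Henkin set.\<close>

fun tsub :: "(string \<times> ty \<Rightarrow> tm) \<Rightarrow> tm \<Rightarrow> tm" where
  "tsub e (Var x \<sigma>) = e (x, \<sigma>)"
| "tsub e (Con c) = Con c"
| "tsub e (s \<cdot> t) = tsub e s \<cdot> tsub e t"

fun fsub :: "(string \<times> ty \<Rightarrow> tm) \<Rightarrow> fm \<Rightarrow> fm" where
  "fsub e (s \<^bold>= t) = (tsub e s \<^bold>= tsub e t)"
| "fsub e (s \<^bold>< t) = (tsub e s \<^bold>< tsub e t)"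
| "fsub e Fls = Fls"
| "fsub e (A \<^bold>\<longrightarrow> B) = (fsub e A \<^bold>\<longrightarrow> fsub e B)"
| "fsub e (All x \<sigma> A) = All x \<sigma> (fsub (e((x, \<sigma>) := Var x \<sigma>)) A)"

lemma tsub_cong: "(\<And>v. v \<in> fv_tm t \<Longrightarrow> e v = e' v) \<Longrightarrow> tsub e t = tsub e' t"
  by (induction t) auto

lemma fsub_cong: "(\<And>v. v \<in> fv A \<Longrightarrow> e v = e' v) \<Longrightarrow> fsub e A = fsub e' A"
proof (induction A arbitrary: e e')
  case (Eq s t)
  then show ?case using tsub_cong[of s e e'] tsub_cong[of t e e'] by simp
next
  case (Less s t)
  then show ?case using tsub_cong[of s e e'] tsub_cong[of t e e'] by simp
next
  case (Imp A B)
  show ?case using Imp.IH(1)[of e e', OF Imp.prems] Imp.IH(2)[of e e', OF Imp.prems] by simp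
next
  case (All x \<sigma> A)
  have "fsub (e((x, \<sigma>) := Var x \<sigma>)) A = fsub (e'((x, \<sigma>) := Var x \<sigma>)) A"
    using All.prems by (intro All.IH) auto
  then show ?case by simp
qed simp

lemma tsub_Var: "tsub (case_prod Var) t = t"
  by (induction t) auto

lemma fsub_Var: "fsub (case_prod Var) A = A"
proof (induction A)
  case (All x \<sigma> A)
  then show ?case by (simp add: fun_upd_idem)
qed (auto simp: tsub_Var)

lemma subst_tsub:
  assumes "\<forall>w. w \<noteq> v \<longrightarrow> v \<notin> fv_tm (e w)"
  shows "subst_tm v u (tsub (e(v := case_prod Var v)) t) = tsub (e(v := u)) t"
proof (induction t)
  case (Var x \<sigma>)
  show ?case
  proof (cases "v = (x, \<sigma>)")
    case False
    then have "v \<notin> fv_tm (e (x, \<sigma>))" using assms by metis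
    then show ?thesis using False by (auto simp: subst_tm_fresh)
  qed simp
qed auto

text \<open>Replacing \<open>v\<close> last gives the same result as replacing it together with the
  others, because no inserted term contains \<open>v\<close>. This is what makes instances of a
  quantified formula agree with updated assignments.\<close>

lemma subst_fsub:
  "\<forall>w. w \<noteq> v \<longrightarrow> v \<notin> fv_tm (e w) \<Longrightarrow>
     subst v u (fsub (e(v := case_prod Var v)) A) = fsub (e(v := u)) A"
proof (induction A arbitrary: e)
  case (All x \<sigma> A)
  show ?case
  proof (cases "v = (x, \<sigma>)")
    case False
    then have *: "\<forall>w. w \<noteq> v \<longrightarrow> v \<notin> fv_tm ((e((x, \<sigma>) := Var x \<sigma>)) w)"
      using All.prems by auto
    have "(e(v := c))((x, \<sigma>) := d) = (e((x, \<sigma>) := d))(v := c)" for c d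
      using False by (simp add: fun_upd_twist)
    then show ?thesis using All.IH[OF *] False by (simp del: fun_upd_apply)
  qed (simp del: fun_upd_apply)
qed (simp_all add: subst_tsub)

lemma bvs_fsub [simp]: "bvs (fsub e A) = bvs A"
  by (induction A arbitrary: e) auto

lemma fv_tsub: "fv_tm (tsub e t) = (\<Union>v\<in>fv_tm t. fv_tm (e v))"
  by (induction t) auto

lemma fv_fsub: "fv (fsub e A) \<subseteq> (\<Union>v\<in>fv A. fv_tm (e v))"
proof (induction A arbitrary: e)
  case (All x \<sigma> A)
  show ?case
  proof
    fix w assume "w \<in> fv (fsub e (All x \<sigma> A))"
    then have w: "w \<noteq> (x, \<sigma>)" "w \<in> fv (fsub (e((x, \<sigma>) := Var x \<sigma>)) A)" by auto
    from w(2) All.IH obtain v where v: "v \<in> fv A" "w \<in> fv_tm ((e((x, \<sigma>) := Var x \<sigma>)) v)"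
      by blast
    with w(1) have "v \<noteq> (x, \<sigma>)" by auto
    with v show "w \<in> (\<Union>v\<in>fv (All x \<sigma> A). fv_tm (e v))" by auto
  qed
qed (simp_all add: fv_tsub, blast+)

definition typed :: "(string \<times> ty \<Rightarrow> tm) \<Rightarrow> bool" where
  "typed e \<longleftrightarrow> (\<forall>x \<sigma>. wt (e (x, \<sigma>)) \<and> ty_of (e (x, \<sigma>)) = \<sigma>)"

lemma ty_of_tsub: "typed e \<Longrightarrow> ty_of (tsub e t) = ty_of t"
  by (induction t) (auto simp: typed_def)

lemma wt_tsub: "typed e \<Longrightarrow> wt t \<Longrightarrow> wt (tsub e t)"
  by (induction t) (auto simp: ty_of_tsub, auto simp: typed_def)

lemma wf_fsub: "typed e \<Longrightarrow> wf_fm A \<Longrightarrow> wf_fm (fsub e A)"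
proof (induction A arbitrary: e)
  case (All x \<sigma> A)
  have "typed (e((x, \<sigma>) := Var x \<sigma>))" using All.prems(1) by (simp add: typed_def)
  then show ?case using All by simp
qed (simp_all add: wt_tsub ty_of_tsub)

text \<open>Generalize and instantiate: in the empty context the eigenvariable condition is vacuous,
  so free variables of theorems behave as universally quantified.\<close>

lemma provable_subst:
  "T \<turnstile> A \<Longrightarrow> wt u \<Longrightarrow> ty_of u = snd v \<Longrightarrow> bvs A \<inter> fv_tm u = {} \<Longrightarrow> T \<turnstile> subst v u A"
  using AllE[of T "{}" "fst v" "snd v" A u] AllI[of T "{}" A "fst v" "snd v"]
  by (simp add: free_for_disjoint)

lemma hterms_subst [simp]: "t \<in> hterms \<sigma> \<Longrightarrow> v \<notin> hvars \<Longrightarrow> subst_tm v u t = t"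
  by (rule subst_tm_fresh) (auto simp: hterms_def)

lemma hterms_app: "s \<in> hterms (\<sigma> \<rightarrow> \<tau>) \<Longrightarrow> t \<in> hterms \<sigma> \<Longrightarrow> s \<cdot> t \<in> hterms \<tau>"
  by (auto simp: hterms_def)

definition henv :: "(string \<times> ty \<Rightarrow> tm) \<Rightarrow> bool" where
  "henv e \<longleftrightarrow> (\<forall>x \<sigma>. e (x, \<sigma>) \<in> hterms \<sigma>)"

text \<open>The variables are replaced one at a time, \<open>V\<close> being the set of those
  already treated. Inserted terms contain Henkin variables only, so later replacements leave them
  alone and the sequence of substitutions equals the simultaneous one.\<close>

lemma provable_fsub:
  assumes "T \<turnstile> A" "(fv A \<union> bvs A) \<inter> hvars = {}" "henv e"
  shows "T \<turnstile> fsub e A"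
proof -
  let ?e = "\<lambda>V v. if v \<in> V then e v else case_prod Var v"
  have h: "fv_tm (e v) \<subseteq> hvars" "wt (e v)" "ty_of (e v) = snd v" for v
    using assms(3) by (cases v; force simp: henv_def hterms_def)+
  have "V \<inter> hvars = {} \<Longrightarrow> T \<turnstile> fsub (?e V) A" if "finite V" for V
    using that
  proof (induction V)
    case empty
    then show ?case using assms(1) by (simp add: fsub_Var)
  next
    case (insert v V)
    have "\<forall>w. w \<noteq> v \<longrightarrow> v \<notin> fv_tm (?e V w)"
      using insert.prems h(1) by (auto split: prod.splits)
    from subst_fsub[OF this, of "e v" A]
    have "subst v (e v) (fsub (?e V) A) = fsub ((?e V)(v := e v)) A"
      using insert.hyps by (simp add: fun_upd_idem)
    moreover have "(?e V)(v := e v) = ?e (insert v V)" by auto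
    moreover have "T \<turnstile> subst v (e v) (fsub (?e V) A)"
      by (rule provable_subst) (use insert h(2,3) h(1)[of v] assms(2) in auto)
    ultimately show ?case by simp
  qed
  from this[OF finite_fv[of A]] have "T \<turnstile> fsub (?e (fv A)) A" using assms(2) by blast
  moreover have "fsub (?e (fv A)) A = fsub e A" by (rule fsub_cong) simp
  ultimately show ?thesis by simp
qed


section \<open>The extensional term model\<close>

context Henkin_set
begin

lemma M_wf: "A \<in> M \<Longrightarrow> wf_fm A"
  using M_good by (simp add: good_def)

lemma M_provable: "T \<turnstile> A \<Longrightarrow> good A \<Longrightarrow> A \<in> M"
  using M_deriv[of "[]"] by simp

lemma Fls_notin_M: "Fls \<notin> M"
  using M_neg[of Fls] M_provable[of "\<^bold>\<not> Fls"] ImpI[OF Hyp[of Fls]] by auto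

lemma M_Imp: "good A \<Longrightarrow> good B \<Longrightarrow> (A \<^bold>\<longrightarrow> B) \<in> M \<longleftrightarrow> (A \<in> M \<longrightarrow> B \<in> M)"
proof (intro iffI impI)
  assume "good A" "good B" and *: "(A \<^bold>\<longrightarrow> B) \<in> M" "A \<in> M"
  have "deriv T (set [A \<^bold>\<longrightarrow> B, A]) B"
    by (rule ImpE[of _ _ A]) (use * M_wf in \<open>auto intro!: Hyp\<close>)
  then show "B \<in> M" using * \<open>good B\<close> M_deriv[of "[A \<^bold>\<longrightarrow> B, A]"] by simp
next
  assume g: "good A" "good B" and *: "A \<in> M \<longrightarrow> B \<in> M"
  then have w: "wf_fm A" "wf_fm B" by (auto simp: good_def)
  show "(A \<^bold>\<longrightarrow> B) \<in> M"
  proof (cases "A \<in> M")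
    case True
    have "deriv T (set [B]) (A \<^bold>\<longrightarrow> B)" by (rule ImpI, rule Hyp) (use w in auto)
    then show ?thesis by (rule M_deriv[rotated]) (use True * g in auto)
  next
    case False
    then have "(\<^bold>\<not> A) \<in> M" using g M_neg by blast
    have "deriv T {\<^bold>\<not> B, A, \<^bold>\<not> A} Fls"
      by (rule ImpE[of _ _ A]) (use w in \<open>auto intro: Hyp\<close>)
    then have "deriv T (set [\<^bold>\<not> A]) (A \<^bold>\<longrightarrow> B)"
      by - (rule ImpI, rule Contr, use w in auto)
    then show ?thesis by (rule M_deriv[rotated]) (use \<open>(\<^bold>\<not> A) \<in> M\<close> g in auto)
  qed
qed

lemma M_All: "good (All x \<sigma> A) \<Longrightarrow> All x \<sigma> A \<in> M \<longleftrightarrow> (\<forall>t\<in>hterms \<sigma>. subst (x, \<sigma>) t A \<in> M)"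
proof (intro iffI ballI)
  fix t assume g: "good (All x \<sigma> A)" and *: "All x \<sigma> A \<in> M" and t: "t \<in> hterms \<sigma>"
  have "deriv T (set [All x \<sigma> A]) (All x \<sigma> A)" using M_wf[OF *] by (auto intro: Hyp)
  then have "deriv T (set [All x \<sigma> A]) (subst (x, \<sigma>) t A)"
    by (rule AllE) (use t g good_free_for in \<open>auto simp: hterms_def\<close>)
  then show "subst (x, \<sigma>) t A \<in> M"
    using M_deriv[of "[All x \<sigma> A]"] * g t good_subst by simp
next
  assume g: "good (All x \<sigma> A)" and *: "\<forall>t\<in>hterms \<sigma>. subst (x, \<sigma>) t A \<in> M"
  show "All x \<sigma> A \<in> M"
  proof (rule ccontr)
    assume "All x \<sigma> A \<notin> M"
    then obtain t where "t \<in> hterms \<sigma>" "(\<^bold>\<not> subst (x, \<sigma>) t A) \<in> M"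
      using M_neg[OF g] M_witness by blast
    then show False using * M_neg good_subst[OF g] by blast
  qed
qed

lemma M_refl: "t \<in> hterms \<iota> \<Longrightarrow> (t \<^bold>= t) \<in> M"
  by (rule M_provable) (auto intro: EqRefl simp: hterms_def)

lemma M_eq_subst:
  assumes "(s \<^bold>= t) \<in> M" "subst (x, \<iota>) s A \<in> M" "good (All x \<iota> A)"
  shows "subst (x, \<iota>) t A \<in> M"
proof -
  have st: "s \<in> hterms \<iota>" "t \<in> hterms \<iota>" using M_good[OF assms(1)] by auto
  let ?L = "[s \<^bold>= t, subst (x, \<iota>) s A]"
  have "deriv T (set ?L) (subst (x, \<iota>) t A)"
    by (rule EqSubst[of _ _ s])
      (use assms st M_wf good_free_for[OF assms(3)] in \<open>auto intro: Hyp simp: good_def\<close>)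
  then show ?thesis using M_deriv[of ?L] assms good_subst[OF assms(3) st(2)] by simp
qed

text \<open>Equality at higher types tested on closed terms alone. By the witness property this
  loses nothing compared with the quantified formula \<open>eqt\<close>.\<close>

fun heq :: "ty \<Rightarrow> tm \<Rightarrow> tm \<Rightarrow> bool" where
  "heq \<iota> s t \<longleftrightarrow> (s \<^bold>= t) \<in> M"
| "heq (\<sigma> \<rightarrow> \<tau>) s t \<longleftrightarrow> (\<forall>u\<in>hterms \<sigma>. heq \<tau> (s \<cdot> u) (t \<cdot> u))"

lemma good_eqt: "s \<in> hterms \<sigma> \<Longrightarrow> t \<in> hterms \<sigma> \<Longrightarrow> good (eqt \<sigma> s t)"
  using fv_eqt[of \<sigma> s t] bvs_eqt[of \<sigma> s t] by (fastforce simp: good_def hterms_def wf_eqt)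

lemma M_eqt: "s \<in> hterms \<sigma> \<Longrightarrow> t \<in> hterms \<sigma> \<Longrightarrow> eqt \<sigma> s t \<in> M \<longleftrightarrow> heq \<sigma> s t"
proof (induction \<sigma> arbitrary: s t)
  case (Fun \<sigma> \<tau>)
  then show ?case
    using M_All[of "zname (arity \<tau>)" \<sigma>] good_eqt[OF Fun.prems]
    by (auto simp: eqt_Fun subst_eqt hterms_app)
qed simp

lemma heq_refl: "t \<in> hterms \<sigma> \<Longrightarrow> heq \<sigma> t t"
  by (induction \<sigma> arbitrary: t) (auto simp: M_refl hterms_app)

lemma heq_sym: "s \<in> hterms \<sigma> \<Longrightarrow> t \<in> hterms \<sigma> \<Longrightarrow> heq \<sigma> s t \<Longrightarrow> heq \<sigma> t s"
proof (induction \<sigma> arbitrary: s t)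
  case TNat
  have "good (All ''x'' \<iota> (Var ''x'' \<iota> \<^bold>= s))"
    using TNat by (auto simp: good_def hterms_def)
  then show ?case
    using M_eq_subst[of s t "''x''" "Var ''x'' \<iota> \<^bold>= s"] TNat M_refl by simp
next
  case (Fun \<sigma> \<tau>)
  then show ?case by (auto simp: hterms_app)
qed

lemma heq_trans:
  "s \<in> hterms \<sigma> \<Longrightarrow> t \<in> hterms \<sigma> \<Longrightarrow> u \<in> hterms \<sigma> \<Longrightarrow> heq \<sigma> s t \<Longrightarrow> heq \<sigma> t u \<Longrightarrow> heq \<sigma> s u"
proof (induction \<sigma> arbitrary: s t u)
  case TNat
  have "good (All ''x'' \<iota> (s \<^bold>= Var ''x'' \<iota>))"
    using TNat by (auto simp: good_def hterms_def)
  then show ?case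
    using M_eq_subst[of t u "''x''" "s \<^bold>= Var ''x'' \<iota>"] TNat M_refl by simp
next
  case (Fun \<sigma> \<tau>)
  show ?case unfolding heq.simps
  proof
    fix v assume v: "v \<in> hterms \<sigma>"
    show "heq \<tau> (s \<cdot> v) (u \<cdot> v)"
      by (rule Fun.IH(2)[of "s \<cdot> v" "t \<cdot> v"]) (use v Fun.prems in \<open>auto simp: hterms_app\<close>)
  qed
qed

end

locale RCA_Henkin_set = Henkin_set "RCA0\<omega>" M for M
begin

text \<open>Pointwise equality of \<open>s\<close> and \<open>t\<close> does not by itself control
  what a functional does with them; the extensionality axiom does. Its variables can be replaced one
  after the other because closed Henkin terms contain none of \<open>x\<close>, \<open>y\<close>,
  \<open>f\<close> and none of the variables bound in \<open>eqt\<close>.\<close>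

lemma heq_app_right:
  assumes "f \<in> hterms (\<rho> \<rightarrow> \<tau>)" "s \<in> hterms \<rho>" "t \<in> hterms \<rho>" "heq \<rho> s t"
  shows "heq \<tau> (f \<cdot> s) (f \<cdot> t)"
proof -
  let ?x = "''x''" and ?y = "''y''" and ?f = "''f''"
  let ?A = "eqt \<rho> (Var ?x \<rho>) (Var ?y \<rho>) \<^bold>\<longrightarrow>
     eqt \<tau> (Var ?f (\<rho> \<rightarrow> \<tau>) \<cdot> Var ?x \<rho>) (Var ?f (\<rho> \<rightarrow> \<tau>) \<cdot> Var ?y \<rho>)"
  have h: "fv_tm u \<inter> bvs (eqt \<sigma> v w) = {}" if "u \<in> hterms \<sigma>'" for u v w \<sigma> \<sigma>'
    using that bvs_eqt[of \<sigma> v w] by (fastforce simp: hterms_def)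
  have "RCA0\<omega> \<turnstile> ?A" by (intro Ax RCA0\<omega>.Ext) auto
  then have "RCA0\<omega> \<turnstile> subst (?x, \<rho>) s (subst (?y, \<rho>) t (subst (?f, \<rho> \<rightarrow> \<tau>) f ?A))"
    using assms h by (intro provable_subst) (auto simp: hterms_def disjoint_iff)
  then have "RCA0\<omega> \<turnstile> eqt \<rho> s t \<^bold>\<longrightarrow> eqt \<tau> (f \<cdot> s) (f \<cdot> t)"
    using assms by (simp add: subst_eqt)
  then have "(eqt \<rho> s t \<^bold>\<longrightarrow> eqt \<tau> (f \<cdot> s) (f \<cdot> t)) \<in> M"
    using assms by (intro M_provable) (auto intro!: good_eqt hterms_app)
  then show ?thesis
    using assms by (simp add: M_Imp good_eqt hterms_app[of f \<rho>] M_eqt)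
qed

lemma heq_app:
  assumes "f \<in> hterms (\<rho> \<rightarrow> \<tau>)" "g \<in> hterms (\<rho> \<rightarrow> \<tau>)" "s \<in> hterms \<rho>" "t \<in> hterms \<rho>"
    "heq (\<rho> \<rightarrow> \<tau>) f g" "heq \<rho> s t"
  shows "heq \<tau> (f \<cdot> s) (g \<cdot> t)"
  by (rule heq_trans[of _ _ "f \<cdot> t"]) (use assms heq_app_right in \<open>auto simp: hterms_app\<close>)

text \<open>A canonical representative of each extensional equality class, so that equality in the model is
  equality of terms.\<close>

definition nf :: "tm \<Rightarrow> tm" where
  "nf t = (SOME u. u \<in> hterms (ty_of t) \<and> heq (ty_of t) t u)"

lemma nf: "t \<in> hterms \<sigma> \<Longrightarrow> nf t \<in> hterms \<sigma> \<and> heq \<sigma> t (nf t)"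
proof -
  assume t: "t \<in> hterms \<sigma>"
  then have "ty_of t = \<sigma>" by (simp add: hterms_def)
  moreover have "nf t \<in> hterms (ty_of t) \<and> heq (ty_of t) t (nf t)"
    unfolding nf_def by (rule someI[of _ t]) (use t calculation heq_refl in auto)
  ultimately show ?thesis by simp
qed

lemma nf_eq:
  assumes "s \<in> hterms \<sigma>" "t \<in> hterms \<sigma>"
  shows "nf s = nf t \<longleftrightarrow> heq \<sigma> s t"
proof
  assume "nf s = nf t"
  then show "heq \<sigma> s t"
    using nf[OF assms(1)] nf[OF assms(2)] assms heq_sym heq_trans by metis
next
  assume st: "heq \<sigma> s t"
  have "u \<in> hterms \<sigma> \<and> heq \<sigma> s u \<longleftrightarrow> u \<in> hterms \<sigma> \<and> heq \<sigma> t u" for u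
    using assms st heq_sym heq_trans by metis
  moreover have "ty_of s = \<sigma>" "ty_of t = \<sigma>" using assms by (auto simp: hterms_def)
  ultimately show "nf s = nf t" unfolding nf_def by simp
qed

lemma nf_nf [simp]: "t \<in> hterms \<sigma> \<Longrightarrow> nf (nf t) = nf t"
  using nf[of t \<sigma>] nf_eq[of t \<sigma> "nf t"] by simp

definition "tdom \<sigma> = nf ` hterms \<sigma>"
definition "tcon c = nf (Con c)"
definition "tapp s t = nf (s \<cdot> t)"
definition "tlt s t \<longleftrightarrow> (s \<^bold>< t) \<in> M"

lemma tapp_nf:
  assumes "s \<in> hterms (\<sigma> \<rightarrow> \<tau>)" "t \<in> hterms \<sigma>"
  shows "tapp (nf s) (nf t) = nf (s \<cdot> t)"
proof -
  have s: "nf s \<in> hterms (\<sigma> \<rightarrow> \<tau>)" "heq (\<sigma> \<rightarrow> \<tau>) (nf s) s"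
    using nf[OF assms(1)] assms(1) heq_sym by blast+
  have t: "nf t \<in> hterms \<sigma>" "heq \<sigma> (nf t) t"
    using nf[OF assms(2)] assms(2) heq_sym by blast+
  have "heq \<tau> (nf s \<cdot> nf t) (s \<cdot> t)"
    by (rule heq_app[OF s(1) assms(1) t(1) assms(2) s(2) t(2)])
  then show ?thesis
    unfolding tapp_def nf_eq[OF hterms_app[OF s(1) t(1)] hterms_app[OF assms]] .
qed

lemma tlt_nf:
  assumes "s \<in> hterms \<iota>" "t \<in> hterms \<iota>"
  shows "tlt (nf s) (nf t) \<longleftrightarrow> (s \<^bold>< t) \<in> M"
proof -
  have cong: "(s' \<^bold>< t') \<in> M"
    if "s \<in> hterms \<iota>" "s' \<in> hterms \<iota>" "t \<in> hterms \<iota>" "t' \<in> hterms \<iota>"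
      "heq \<iota> s s'" "heq \<iota> t t'" "(s \<^bold>< t) \<in> M" for s s' t t'
  proof -
    have "good (All ''x'' \<iota> (Var ''x'' \<iota> \<^bold>< t))" "good (All ''x'' \<iota> (s' \<^bold>< Var ''x'' \<iota>))"
      using that by (auto simp: good_def hterms_def)
    then show ?thesis
      using M_eq_subst[of s s' "''x''" "Var ''x'' \<iota> \<^bold>< t"]
        M_eq_subst[of t t' "''x''" "s' \<^bold>< Var ''x'' \<iota>"] that by simp
  qed
  show ?thesis unfolding tlt_def
    using cong[of s "nf s" t "nf t"] cong[of "nf s" s "nf t" t] assms nf heq_sym by blast
qed

lemma tsub_hterms: "henv e \<Longrightarrow> wt t \<Longrightarrow> tsub e t \<in> hterms (ty_of t)"
proof (induction t)
  case (App s t)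
  then show ?case using hterms_app[of "tsub e s" "ty_of t"] by (auto simp: split: ty.splits)
qed (auto simp: henv_def hterms_def)

lemma val_nf: "henv e \<Longrightarrow> wt t \<Longrightarrow> val tcon tapp (nf \<circ> e) t = nf (tsub e t)"
proof (induction t)
  case (App s t)
  then have "tsub e s \<in> hterms (ty_of t \<rightarrow> ty_of (s \<cdot> t))" "tsub e t \<in> hterms (ty_of t)"
    using tsub_hterms[of e s] tsub_hterms[of e t] by auto
  from tapp_nf[OF this] show ?case using App by simp
qed (auto simp: tcon_def)

lemma good_fsub:
  assumes "henv e" "wf_fm A" "bvs A \<inter> hvars = {}"
  shows "good (fsub e A)"
proof -
  have "typed e" "\<And>v. fv_tm (e v) \<subseteq> hvars"
    using assms(1) by (auto simp: henv_def hterms_def typed_def)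
  then show ?thesis
    using assms wf_fsub[of e A] fv_fsub[of e A] unfolding good_def by fastforce
qed

text \<open>The assignment \<open>e\<close> keeps arbitrary representatives and is normalized only
  on the semantic side. A quantifier over the domain thereby becomes one over all closed terms, as
  in \<open>M_All\<close>.\<close>

lemma truth:
  "henv e \<Longrightarrow> wf_fm A \<Longrightarrow> bvs A \<inter> hvars = {} \<Longrightarrow>
     sat tdom tcon tapp tlt (nf \<circ> e) A \<longleftrightarrow> fsub e A \<in> M"
proof (induction A arbitrary: e)
  case (Eq s t)
  then show ?case
    using nf_eq[of "tsub e s" \<iota> "tsub e t"] tsub_hterms[of e s] tsub_hterms[of e t]
    by (simp add: val_nf[unfolded comp_def] comp_def)
next
  case (Less s t)
  then show ?case
    using tlt_nf[of "tsub e s" "tsub e t"] tsub_hterms[of e s] tsub_hterms[of e t]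
    by (simp add: val_nf[unfolded comp_def] comp_def)
next
  case Fls
  then show ?case by (simp add: Fls_notin_M)
next
  case (Imp A B)
  then show ?case using good_fsub[of e A] good_fsub[of e B] by (auto simp: M_Imp Int_Un_distrib2)
next
  case (All x \<sigma> A)
  have x: "(x, \<sigma>) \<notin> hvars" using All.prems by auto
  have "\<forall>w. w \<noteq> (x, \<sigma>) \<longrightarrow> (x, \<sigma>) \<notin> fv_tm (e w)"
    using All.prems(1) x by (fastforce simp: henv_def hterms_def)
  from subst_fsub[OF this]
  have s: "subst (x, \<sigma>) t (fsub (e((x, \<sigma>) := Var x \<sigma>)) A) = fsub (e((x, \<sigma>) := t)) A" for t by simp
  have "sat tdom tcon tapp tlt (nf \<circ> e) (All x \<sigma> A) \<longleftrightarrow>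
      (\<forall>t\<in>hterms \<sigma>. sat tdom tcon tapp tlt (nf \<circ> (e((x, \<sigma>) := t))) A)"
    by (simp add: tdom_def fun_upd_comp)
  also have "\<dots> \<longleftrightarrow> (\<forall>t\<in>hterms \<sigma>. fsub (e((x, \<sigma>) := t)) A \<in> M)"
    using All by (intro ball_cong refl All.IH) (auto simp: henv_def)
  also have "\<dots> \<longleftrightarrow> fsub e (All x \<sigma> A) \<in> M"
    using M_All[of x \<sigma>] good_fsub[OF All.prems] by (simp add: s)
  finally show ?case .
qed

lemma valuation_nf:
  assumes "valuation tdom e"
  shows "henv e" "nf \<circ> e = e"
proof -
  have *: "\<exists>t\<in>hterms \<sigma>. e (x, \<sigma>) = nf t" for x \<sigma>
    using assms by (auto simp: valuation_def tdom_def)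
  show "henv e" unfolding henv_def using * nf by metis
  show "nf \<circ> e = e"
  proof
    fix v show "(nf \<circ> e) v = e v" using *[where x = "fst v" and \<sigma> = "snd v"] by auto
  qed
qed

text \<open>Axioms may be open; all their instances by closed terms are provable, hence lie in
  \<open>M\<close>. Avoiding the Henkin variables excludes capture in these instances.\<close>

lemma sat_axiom:
  assumes "A \<in> RCA0\<omega>" "wf_fm A" "(fv A \<union> bvs A) \<inter> hvars = {}" "valuation tdom e"
  shows "sat tdom tcon tapp tlt e A"
proof -
  have "RCA0\<omega> \<turnstile> fsub e A"
    using assms by (intro provable_fsub Ax) (auto simp: valuation_nf)
  then have "fsub e A \<in> M"
    using assms by (intro M_provable good_fsub valuation_nf) auto
  then show ?thesis
    using truth[of e A] assms by (auto simp: valuation_nf)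
qed

lemma ex_valuation: "\<exists>e. valuation tdom e"
proof -
  have "nf (Var ''#'' \<sigma>) \<in> tdom \<sigma>" for \<sigma>
    by (auto simp: tdom_def hterms_def hvars_def)
  then show ?thesis by (intro exI[of _ "\<lambda>(x, \<sigma>). nf (Var ''#'' \<sigma>)"]) (auto simp: valuation_def)
qed

lemma tapp_in: "f \<in> tdom (\<sigma> \<rightarrow> \<tau>) \<Longrightarrow> a \<in> tdom \<sigma> \<Longrightarrow> tapp f a \<in> tdom \<tau>"
  by (auto simp: tdom_def tapp_nf hterms_app)

lemma tcon_in: "tcon c \<in> tdom (const_ty c)"
  by (auto simp: tdom_def tcon_def hterms_def)

lemma tapp_ext:
  assumes "f \<in> tdom (\<sigma> \<rightarrow> \<tau>)" "g \<in> tdom (\<sigma> \<rightarrow> \<tau>)" "\<And>a. a \<in> tdom \<sigma> \<Longrightarrow> tapp f a = tapp g a"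
  shows "f = g"
proof -
  obtain s t where *: "s \<in> hterms (\<sigma> \<rightarrow> \<tau>)" "t \<in> hterms (\<sigma> \<rightarrow> \<tau>)" "f = nf s" "g = nf t"
    using assms by (auto simp: tdom_def)
  have "heq \<tau> (s \<cdot> u) (t \<cdot> u)" if "u \<in> hterms \<sigma>" for u
    using assms(3)[of "nf u"] that * nf_eq[of "s \<cdot> u" \<tau> "t \<cdot> u"]
    by (auto simp: tdom_def tapp_nf hterms_app)
  then show ?thesis using * nf_eq[of s "\<sigma> \<rightarrow> \<tau>" t] by simp
qed

end

section \<open>Models\<close>

lemma lam_wt: "wt t \<Longrightarrow> ty_of (lam x \<sigma> t) = \<sigma> \<rightarrow> ty_of t \<and> wt (lam x \<sigma> t)"
  by (induction t) auto

lemma ty_of_lam [simp]: "wt t \<Longrightarrow> ty_of (lam x \<sigma> t) = \<sigma> \<rightarrow> ty_of t"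
  and wt_lam [simp]: "wt t \<Longrightarrow> wt (lam x \<sigma> t)"
  by (simp_all add: lam_wt)

lemma fv_lam [simp]: "fv_tm (lam x \<sigma> t) = fv_tm t - {(x, \<sigma>)}"
  by (induction t) auto

declare lam.simps [simp del]

lemma closed_terms [simp]:
  "wt pow2" "ty_of pow2 = \<iota> \<rightarrow> \<iota>" "fv_tm pow2 = {}"
  "wt initseg" "ty_of initseg = (\<iota> \<rightarrow> \<iota>) \<rightarrow> \<iota> \<rightarrow> \<iota>" "fv_tm initseg = {}"
  "wt iszero" "ty_of iszero = \<iota> \<rightarrow> \<iota>" "fv_tm iszero = {}"
  "wt parity" "ty_of parity = \<iota> \<rightarrow> \<iota>" "fv_tm parity = {}"
  "wt half" "ty_of half = \<iota> \<rightarrow> \<iota>" "fv_tm half = {}"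
  "wt dpt" "ty_of dpt = \<iota> \<rightarrow> \<iota> \<rightarrow> \<iota>" "fv_tm dpt = {}"
  by (auto simp: pow2_def initseg_def iszero_def parity_def half_def dpt_def)

text \<open>Conjunction is a clause of its own because \<open>rel\<close> and \<open>d_less\<close>
  bring existential quantifiers into the matrix of \<open>defined_at\<close>; this avoids passing to
  prenex form.\<close>

inductive sigma1 :: "fm \<Rightarrow> bool" where
  qf: "qf A \<Longrightarrow> sigma1 A"
| Ex: "sigma1 A \<Longrightarrow> sigma1 (Ex x \<iota> A)"
| And: "sigma1 A \<Longrightarrow> sigma1 B \<Longrightarrow> sigma1 (A \<^bold>\<and> B)"

lemma sigma1_Exs: "sigma1 A \<Longrightarrow> sigma1 (Exs xs A)"
  by (induction xs) (auto simp: Exs_def intro: sigma1.Ex)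

lemma sigma1_rel: "sigma1 (rel \<Phi> a p q b u v)"
  unfolding rel_def Let_def
  by (intro sigma1.And sigma1_Exs) (rule sigma1.qf, simp add: posrat_def)+

lemma sigma1_defined_at: "sigma1 (defined_at \<Phi> x)"
  unfolding defined_at_def d_less_def d_add_less_def Let_def
  by (intro sigma1.And sigma1_Exs sigma1_rel sigma1.Ex) (rule sigma1.qf, simp)+

text \<open>The interface between the term model and the mathematical argument. Extensionality is
  stated with genuine identity, so \<open>eqt\<close> may be read as equality.\<close>

locale RCA_model =
  fixes dm :: "ty \<Rightarrow> 'm set" and con :: "const \<Rightarrow> 'm"
    and app :: "'m \<Rightarrow> 'm \<Rightarrow> 'm" (infixl "\<bullet>" 90) and lt :: "'m \<Rightarrow> 'm \<Rightarrow> bool"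
  assumes con_in: "con c \<in> dm (const_ty c)"
    and app_in: "f \<in> dm (\<sigma> \<rightarrow> \<tau>) \<Longrightarrow> a \<in> dm \<sigma> \<Longrightarrow> f \<bullet> a \<in> dm \<tau>"
    and app_ext: "f \<in> dm (\<sigma> \<rightarrow> \<tau>) \<Longrightarrow> g \<in> dm (\<sigma> \<rightarrow> \<tau>) \<Longrightarrow> (\<And>a. a \<in> dm \<sigma> \<Longrightarrow> f \<bullet> a = g \<bullet> a) \<Longrightarrow> f = g"
    and ex_val: "\<exists>e. valuation dm e"
    and axiom: "A \<in> RCA0\<omega> \<Longrightarrow> wf_fm A \<Longrightarrow> (fv A \<union> bvs A) \<inter> hvars = {} \<Longrightarrow> valuation dm e \<Longrightarrow>
      sat dm con app lt e A"
begin

abbreviation "ev \<equiv> val con app"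
abbreviation "holds \<equiv> sat dm con app lt"
abbreviation "N \<equiv> dm \<iota>"
abbreviation "zer \<equiv> con CZero"
abbreviation "un \<equiv> con COne"
abbreviation add :: "'m \<Rightarrow> 'm \<Rightarrow> 'm" where "add a b \<equiv> con CPlus \<bullet> a \<bullet> b"
abbreviation mul :: "'m \<Rightarrow> 'm \<Rightarrow> 'm" where "mul a b \<equiv> con CTimes \<bullet> a \<bullet> b"

lemma ev_in: "valuation dm e \<Longrightarrow> wt t \<Longrightarrow> ev e t \<in> dm (ty_of t)"
proof (induction t)
  case (App s t)
  then show ?case using app_in[of "ev e s" "ty_of t"] by (auto split: ty.splits)
qed (auto simp: valuation_def con_in)

lemma zer_in [simp]: "zer \<in> N" and un_in [simp]: "un \<in> N"
  and plus_in [simp]: "con CPlus \<in> dm (\<iota> \<rightarrow> \<iota> \<rightarrow> \<iota>)"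
  and times_in [simp]: "con CTimes \<in> dm (\<iota> \<rightarrow> \<iota> \<rightarrow> \<iota>)"
  and rec_in [simp]: "con CRec \<in> dm ((\<iota> \<rightarrow> \<iota> \<rightarrow> \<iota>) \<rightarrow> \<iota> \<rightarrow> \<iota> \<rightarrow> \<iota>)"
  using con_in[of CZero] con_in[of COne] con_in[of CPlus] con_in[of CTimes] con_in[of CRec]
  by simp_all

lemma add_in [simp]: "a \<in> N \<Longrightarrow> b \<in> N \<Longrightarrow> add a b \<in> N"
  and mul_in [simp]: "a \<in> N \<Longrightarrow> b \<in> N \<Longrightarrow> mul a b \<in> N"
  using app_in plus_in times_in by blast+

text \<open>Each arrow of the type contributes one use of \<open>app_ext\<close>. The condition on
  names keeps the quantifiers inside \<open>eqt\<close> from capturing variables of \<open>s\<close>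
  and \<open>t\<close>.\<close>

lemma holds_eqt:
  "valuation dm e \<Longrightarrow> wt s \<Longrightarrow> wt t \<Longrightarrow> ty_of s = \<sigma> \<Longrightarrow> ty_of t = \<sigma> \<Longrightarrow>
     \<forall>n<arity \<sigma>. \<forall>\<sigma>'. (zname n, \<sigma>') \<notin> fv_tm s \<union> fv_tm t \<Longrightarrow>
     holds e (eqt \<sigma> s t) \<longleftrightarrow> ev e s = ev e t"
proof (induction \<sigma> arbitrary: s t e)
  case (Fun \<sigma> \<tau>)
  let ?z = "zname (arity \<tau>)"
  have "holds (e((?z, \<sigma>) := a)) (eqt \<tau> (s \<cdot> Var ?z \<sigma>) (t \<cdot> Var ?z \<sigma>)) \<longleftrightarrow>
      ev e s \<bullet> a = ev e t \<bullet> a" if a: "a \<in> dm \<sigma>" for a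
  proof -
    let ?e = "e((?z, \<sigma>) := a)"
    have "ev ?e s = ev e s" "ev ?e t = ev e t"
      using Fun.prems(6) by (auto intro!: val_cong)
    moreover have "holds ?e (eqt \<tau> (s \<cdot> Var ?z \<sigma>) (t \<cdot> Var ?z \<sigma>)) \<longleftrightarrow>
        ev ?e (s \<cdot> Var ?z \<sigma>) = ev ?e (t \<cdot> Var ?z \<sigma>)"
      by (rule Fun.IH(2)[OF valuation_upd[OF Fun.prems(1) a]]) (use Fun.prems in auto)
    ultimately show ?thesis by simp
  qed
  moreover have "ev e s \<in> dm (\<sigma> \<rightarrow> \<tau>)" "ev e t \<in> dm (\<sigma> \<rightarrow> \<tau>)"
    using ev_in[of e s] ev_in[of e t] Fun.prems by auto
  ultimately show ?case by (auto simp: eqt_Fun intro: app_ext)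
qed simp

section \<open>Combinators and explicit definition\<close>

lemma K_eq: 
  assumes "a \<in> dm \<rho>" "b \<in> dm \<tau>"
  shows "con (CK \<rho> \<tau>) \<bullet> a \<bullet> b = a"
proof -
  obtain e0 where e0: "valuation dm e0" using ex_val by blast
  let ?s = "Con (CK \<rho> \<tau>) \<cdot> Var ''x'' \<rho> \<cdot> Var ''y'' \<tau>" and ?t = "Var ''x'' \<rho>"
  let ?e = "e0((''x'', \<rho>) := a, (''y'', \<tau>) := b)"
  have "holds ?e (eqt \<rho> ?s ?t)"
    by (rule axiom[OF RCA0\<omega>.AxK])
      (use e0 assms fv_eqt[of \<rho> ?s ?t] bvs_eqt[of \<rho> ?s ?t] in \<open>fastforce simp: wf_eqt\<close>)+
  then show ?thesis using holds_eqt[of ?e ?s ?t \<rho>] e0 assms by simp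
qed

lemma S_eq:
  assumes "f \<in> dm (\<rho> \<rightarrow> \<sigma> \<rightarrow> \<tau>)" "g \<in> dm (\<rho> \<rightarrow> \<sigma>)" "a \<in> dm \<rho>"
  shows "con (CS \<rho> \<sigma> \<tau>) \<bullet> f \<bullet> g \<bullet> a = f \<bullet> a \<bullet> (g \<bullet> a)"
proof -
  obtain e0 where e0: "valuation dm e0" using ex_val by blast
  let ?x = "Var ''x'' (\<rho> \<rightarrow> \<sigma> \<rightarrow> \<tau>)" and ?y = "Var ''y'' (\<rho> \<rightarrow> \<sigma>)" and ?w = "Var ''w'' \<rho>"
  let ?s = "Con (CS \<rho> \<sigma> \<tau>) \<cdot> ?x \<cdot> ?y \<cdot> ?w" and ?t = "?x \<cdot> ?w \<cdot> (?y \<cdot> ?w)"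
  let ?e = "e0((''x'', \<rho> \<rightarrow> \<sigma> \<rightarrow> \<tau>) := f, (''y'', \<rho> \<rightarrow> \<sigma>) := g, (''w'', \<rho>) := a)"
  have "holds ?e (eqt \<tau> ?s ?t)"
    by (rule axiom[OF RCA0\<omega>.AxS[OF refl refl refl]])
      (use e0 assms fv_eqt[of \<tau> ?s ?t] bvs_eqt[of \<tau> ?s ?t] in \<open>fastforce simp: wf_eqt\<close>)+
  then show ?thesis using holds_eqt[of ?e ?s ?t \<tau>] e0 assms by simp
qed

lemma beta:
  "valuation dm e \<Longrightarrow> wt t \<Longrightarrow> a \<in> dm \<sigma> \<Longrightarrow> ev e (lam x \<sigma> t) \<bullet> a = ev (e((x, \<sigma>) := a)) t"
proof (induction t)
  case (Var y \<tau>)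
  have "con (CK \<sigma> (\<sigma> \<rightarrow> \<sigma>)) \<in> dm (\<sigma> \<rightarrow> (\<sigma> \<rightarrow> \<sigma>) \<rightarrow> \<sigma>)" "con (CK \<sigma> \<sigma>) \<in> dm (\<sigma> \<rightarrow> \<sigma> \<rightarrow> \<sigma>)"
    using con_in[of "CK \<sigma> (\<sigma> \<rightarrow> \<sigma>)"] con_in[of "CK \<sigma> \<sigma>"] by auto
  moreover from this have "con (CK \<sigma> \<sigma>) \<bullet> a \<in> dm (\<sigma> \<rightarrow> \<sigma>)" using Var by (auto intro: app_in)
  ultimately show ?case
    using Var by (auto simp: lam.simps S_eq K_eq valuation_def)
next
  case (Con c)
  then show ?case by (simp add: lam.simps K_eq con_in)
next
  case (App s t)
  obtain \<tau> where *: "wt s" "wt t" "ty_of s = ty_of t \<rightarrow> \<tau>" "ty_of (s \<cdot> t) = \<tau>"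
    using App.prems(2) by auto
  have "ev e (lam x \<sigma> s) \<in> dm (\<sigma> \<rightarrow> ty_of t \<rightarrow> \<tau>)" "ev e (lam x \<sigma> t) \<in> dm (\<sigma> \<rightarrow> ty_of t)"
    using ev_in[OF App.prems(1), of "lam x \<sigma> s"] ev_in[OF App.prems(1), of "lam x \<sigma> t"] * by auto
  then show ?case using App * by (simp add: lam.simps S_eq)
qed

text \<open>The way to obtain explicitly defined functionals: parameters are stored in the valuation
  under suitable names, and the defining term is abstracted over the argument.\<close>

lemma abstraction:
  assumes "valuation dm e" "wt t" "ty_of t = \<tau>"
  shows "\<exists>f\<in>dm (\<sigma> \<rightarrow> \<tau>). \<forall>a\<in>dm \<sigma>. f \<bullet> a = ev (e((x, \<sigma>) := a)) t"
  using ev_in[OF assms(1), of "lam x \<sigma> t"] beta[of e t] assms by auto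

lemma abstraction2:
  assumes "valuation dm e" "wt t" "ty_of t = \<tau>"
  shows "\<exists>f\<in>dm (\<sigma> \<rightarrow> \<sigma>' \<rightarrow> \<tau>). \<forall>a\<in>dm \<sigma>. \<forall>b\<in>dm \<sigma>'.
    f \<bullet> a \<bullet> b = ev (e((x, \<sigma>) := a, (x', \<sigma>') := b)) t"
proof -
  obtain f where f: "f \<in> dm (\<sigma> \<rightarrow> \<sigma>' \<rightarrow> \<tau>)"
    "\<forall>a\<in>dm \<sigma>. f \<bullet> a = ev (e((x, \<sigma>) := a)) (lam x' \<sigma>' t)"
    using abstraction[OF assms(1), of "lam x' \<sigma>' t" "\<sigma>' \<rightarrow> \<tau>" \<sigma> x] assms by auto
  have "f \<bullet> a \<bullet> b = ev (e((x, \<sigma>) := a, (x', \<sigma>') := b)) t" if "a \<in> dm \<sigma>" "b \<in> dm \<sigma>'" for a b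
    using f(2) that beta[of "e((x, \<sigma>) := a)" t b \<sigma>' x'] assms by simp
  then show ?thesis using f(1) by blast
qed

section \<open>Recursion, arithmetic and induction\<close>

lemma rec_zer:
  assumes "f \<in> dm (\<iota> \<rightarrow> \<iota> \<rightarrow> \<iota>)" "a \<in> N"
  shows "con CRec \<bullet> f \<bullet> a \<bullet> zer = a"
proof -
  obtain e0 where e0: "valuation dm e0" using ex_val by blast
  show ?thesis
    using axiom[OF RCA0\<omega>.Rec0[OF refl], of "e0((''f'', \<iota> \<rightarrow> \<iota> \<rightarrow> \<iota>) := f, (''m'', \<iota>) := a)"] e0 assms
    by simp
qed

lemma rec_suc:
  assumes "f \<in> dm (\<iota> \<rightarrow> \<iota> \<rightarrow> \<iota>)" "a \<in> N" "n \<in> N"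
  shows "con CRec \<bullet> f \<bullet> a \<bullet> add n un = f \<bullet> n \<bullet> (con CRec \<bullet> f \<bullet> a \<bullet> n)"
proof -
  obtain e0 where e0: "valuation dm e0" using ex_val by blast
  show ?thesis
    using axiom[OF RCA0\<omega>.RecS[OF refl],
        of "e0((''f'', \<iota> \<rightarrow> \<iota> \<rightarrow> \<iota>) := f, (''m'', \<iota>) := a, (''n'', \<iota>) := n)"] e0 assms
    by simp
qed

lemma arith:
  assumes "a \<in> N" "b \<in> N" "c \<in> N"
  shows add_comm: "add a b = add b a"
    and add_assoc: "add (add a b) c = add a (add b c)"
    and add_zer: "add a zer = a"
    and mul_comm: "mul a b = mul b a"
    and mul_zer: "mul a zer = zer"
    and lt_irrefl: "\<not> lt a a"
    and lt_add: "lt a b \<Longrightarrow> lt (add a c) (add b c)"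
    and lt_mul: "lt a b \<Longrightarrow> lt zer c \<Longrightarrow> lt (mul a c) (mul b c)"
    and lt_trans: "lt a b \<Longrightarrow> lt b c \<Longrightarrow> lt a c"
    and lt_zer_un: "lt zer un"
    and zer_le: "lt zer a \<or> zer = a"
proof -
  obtain e0 where e0: "valuation dm e0" using ex_val by blast
  let ?e = "e0((''x'', \<iota>) := a, (''y'', \<iota>) := b, (''z'', \<iota>) := c)"
  have *: "A \<in> arith_axioms \<Longrightarrow> wf_fm A \<Longrightarrow> (fv A \<union> bvs A) \<inter> hvars = {} \<Longrightarrow> holds ?e A" for A
    using axiom[OF RCA0\<omega>.Arith, of A ?e] e0 assms by simp
  let ?x = "v0 ''x''" and ?y = "v0 ''y''" and ?z = "v0 ''z''"
  show "add a b = add b a" using *[of "?x \<oplus> ?y \<^bold>= ?y \<oplus> ?x"] by (simp add: arith_axioms_def Let_def)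
  show "add (add a b) c = add a (add b c)"
    using *[of "(?x \<oplus> ?y) \<oplus> ?z \<^bold>= ?x \<oplus> (?y \<oplus> ?z)"] by (simp add: arith_axioms_def Let_def)
  show "add a zer = a" using *[of "?x \<oplus> \<^bold>0 \<^bold>= ?x"] by (simp add: arith_axioms_def Let_def)
  show "mul a b = mul b a" using *[of "?x \<otimes> ?y \<^bold>= ?y \<otimes> ?x"] by (simp add: arith_axioms_def Let_def)
  show "mul a zer = zer" using *[of "?x \<otimes> \<^bold>0 \<^bold>= \<^bold>0"] by (simp add: arith_axioms_def Let_def)
  show "\<not> lt a a" using *[of "\<^bold>\<not> ?x \<^bold>< ?x"] by (simp add: arith_axioms_def Let_def)
  show "lt (add a c) (add b c)" if "lt a b"
    using *[of "?x \<^bold>< ?y \<^bold>\<longrightarrow> ?x \<oplus> ?z \<^bold>< ?y \<oplus> ?z"] that by (simp add: arith_axioms_def Let_def)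
  show "lt (mul a c) (mul b c)" if "lt a b" "lt zer c"
    using *[of "?x \<^bold>< ?y \<^bold>\<longrightarrow> \<^bold>0 \<^bold>< ?z \<^bold>\<longrightarrow> ?x \<otimes> ?z \<^bold>< ?y \<otimes> ?z"] that
    by (simp add: arith_axioms_def Let_def)
  show "lt a c" if "lt a b" "lt b c"
    using *[of "?x \<^bold>< ?y \<^bold>\<longrightarrow> ?y \<^bold>< ?z \<^bold>\<longrightarrow> ?x \<^bold>< ?z"] that by (simp add: arith_axioms_def Let_def)
  show "lt zer un" using *[of "\<^bold>0 \<^bold>< \<^bold>1"] by (simp add: arith_axioms_def Let_def)
  show "lt zer a \<or> zer = a" using *[of "\<^bold>0 \<^bold>\<le> ?x"] by (auto simp: arith_axioms_def Let_def)
qed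

lemma un_neq_zer [simp]: "un \<noteq> zer"
  using lt_zer_un lt_irrefl by (metis zer_in)

lemma mul_eq_zer: "a \<in> N \<Longrightarrow> b \<in> N \<Longrightarrow> mul a b = zer \<longleftrightarrow> a = zer \<or> b = zer"
  using lt_mul[of zer a b] mul_zer mul_comm zer_le lt_irrefl by (metis zer_in)

lemma add_eq_zer: "a \<in> N \<Longrightarrow> b \<in> N \<Longrightarrow> add a b = zer \<longleftrightarrow> a = zer \<and> b = zer"
proof -
  have "a = zer" if "a \<in> N" "b \<in> N" "add a b = zer" for a b
  proof (rule ccontr)
    assume "a \<noteq> zer"
    then have "lt (add zer b) (add a b)" using that zer_le[of a] lt_add[of zer a b] by simp
    moreover have "add zer b = b" using that add_comm add_zer by (metis zer_in)
    ultimately have "lt b zer" using that by simp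
    then show False using that zer_le[of b] lt_trans[of zer b zer] lt_irrefl[of zer] by auto
  qed
  then show "a \<in> N \<Longrightarrow> b \<in> N \<Longrightarrow> ?thesis" using add_comm add_zer by (metis zer_in)
qed

text \<open>Induction over a possibly nonstandard \<open>N\<close> is restricted to quantifier-free
  formulas, so the property has to be presented as the zero set of an element of the model, or as
  its complement in the companion lemma.\<close>

lemma induct_eq_zer:
  assumes "g \<in> dm (\<iota> \<rightarrow> \<iota>)" "g \<bullet> zer = zer" "\<And>n. n \<in> N \<Longrightarrow> g \<bullet> n = zer \<Longrightarrow> g \<bullet> add n un = zer"
    and "n \<in> N"
  shows "g \<bullet> n = zer"
proof -
  obtain e0 where e0: "valuation dm e0" using ex_val by blast
  show ?thesis
    using axiom[OF RCA0\<omega>.QFInd[of "v1 ''g'' \<cdot> v0 ''n'' \<^bold>= \<^bold>0" "''n''"],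
        of "e0((''g'', \<iota> \<rightarrow> \<iota>) := g)"] e0 assms by simp
qed

lemma induct_neq_zer:
  assumes "g \<in> dm (\<iota> \<rightarrow> \<iota>)" "g \<bullet> zer \<noteq> zer" "\<And>n. n \<in> N \<Longrightarrow> g \<bullet> n \<noteq> zer \<Longrightarrow> g \<bullet> add n un \<noteq> zer"
    and "n \<in> N"
  shows "g \<bullet> n \<noteq> zer"
proof -
  obtain e0 where e0: "valuation dm e0" using ex_val by blast
  show ?thesis
    using axiom[OF RCA0\<omega>.QFInd[of "\<^bold>\<not> v1 ''g'' \<cdot> v0 ''n'' \<^bold>= \<^bold>0" "''n''"],
        of "e0((''g'', \<iota> \<rightarrow> \<iota>) := g)"] e0 assms by simp
qed

section \<open>Choice and characteristic functionals\<close>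

lemma qf_choice:
  assumes A: "qf A" "wf_fm A" "fv A \<inter> hvars = {}" "(''Y'', (\<iota> \<rightarrow> \<iota>) \<rightarrow> \<iota>) \<notin> fv A"
    and e: "valuation dm e"
    and ex: "\<And>a. a \<in> dm (\<iota> \<rightarrow> \<iota>) \<Longrightarrow> \<exists>b\<in>N. holds (e((''x'', \<iota> \<rightarrow> \<iota>) := a, (''y'', \<iota>) := b)) A"
  shows "\<exists>Y\<in>dm ((\<iota> \<rightarrow> \<iota>) \<rightarrow> \<iota>). \<forall>a\<in>dm (\<iota> \<rightarrow> \<iota>).
    holds (e((''x'', \<iota> \<rightarrow> \<iota>) := a, (''y'', \<iota>) := Y \<bullet> a)) A"
proof -
  let ?x = "(''x'', \<iota> \<rightarrow> \<iota>)" and ?y = "(''y'', \<iota>)" and ?Y = "(''Y'', (\<iota> \<rightarrow> \<iota>) \<rightarrow> \<iota>)"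
  let ?t = "v2 ''Y'' \<cdot> v1 ''x''"
  have bv: "bvs A = {}" using A(1) by (induction A) auto
  have "holds e (All ''x'' (\<iota> \<rightarrow> \<iota>) (Ex ''y'' \<iota> A) \<^bold>\<longrightarrow>
      Ex ''Y'' ((\<iota> \<rightarrow> \<iota>) \<rightarrow> \<iota>) (All ''x'' (\<iota> \<rightarrow> \<iota>) (subst ?y ?t A)))"
    using A e bv fv_subst[of ?y ?t A]
    by (intro axiom[OF RCA0\<omega>.QFAC10]) (auto simp: wf_subst)
  moreover have "holds e (All ''x'' (\<iota> \<rightarrow> \<iota>) (Ex ''y'' \<iota> A))"
    using ex by simp
  ultimately obtain Y where Y: "Y \<in> dm ((\<iota> \<rightarrow> \<iota>) \<rightarrow> \<iota>)"
    and h: "\<And>a. a \<in> dm (\<iota> \<rightarrow> \<iota>) \<Longrightarrow> holds (e(?Y := Y, ?x := a)) (subst ?y ?t A)"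
    by auto
  have "holds (e(?x := a, ?y := Y \<bullet> a)) A" if a: "a \<in> dm (\<iota> \<rightarrow> \<iota>)" for a
  proof -
    have "holds (e(?Y := Y, ?x := a, ?y := Y \<bullet> a)) A"
      using h[OF a] by (simp add: sat_subst_qf[OF A(1)])
    moreover have "holds (e(?Y := Y, ?x := a, ?y := Y \<bullet> a)) A = holds (e(?x := a, ?y := Y \<bullet> a)) A"
      by (rule sat_cong) (use A(4) in auto)
    ultimately show ?thesis by simp
  qed
  then show ?thesis using Y by blast
qed

text \<open>The equivalence of \<open>A\<close> with \<open>y = 0\<close> is again quantifier-free
  and always solvable, by 0 or 1 according to the truth of \<open>A\<close>. Choosing a solution
  yields the characteristic functional.\<close>

lemma qf_characteristic:
  assumes A: "qf A" "wf_fm A" "fv A \<inter> hvars = {}" "(''Y'', (\<iota> \<rightarrow> \<iota>) \<rightarrow> \<iota>) \<notin> fv A" "(''y'', \<iota>) \<notin> fv A"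
    and e: "valuation dm e"
  shows "\<exists>C\<in>dm ((\<iota> \<rightarrow> \<iota>) \<rightarrow> \<iota>). \<forall>a\<in>dm (\<iota> \<rightarrow> \<iota>). holds (e((''x'', \<iota> \<rightarrow> \<iota>) := a)) A \<longleftrightarrow> C \<bullet> a = zer"
proof -
  let ?x = "(''x'', \<iota> \<rightarrow> \<iota>)" and ?y = "(''y'', \<iota>)"
  have c: "holds (e(?x := a, ?y := b)) A = holds (e(?x := a)) A" for a b
    by (rule sat_cong) (use A(5) in auto)
  have "\<exists>Y\<in>dm ((\<iota> \<rightarrow> \<iota>) \<rightarrow> \<iota>). \<forall>a\<in>dm (\<iota> \<rightarrow> \<iota>).
      holds (e(?x := a, ?y := Y \<bullet> a)) (A \<^bold>\<longleftrightarrow> v0 ''y'' \<^bold>= \<^bold>0)"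
  proof (rule qf_choice)
    fix a assume "a \<in> dm (\<iota> \<rightarrow> \<iota>)"
    show "\<exists>b\<in>N. holds (e(?x := a, ?y := b)) (A \<^bold>\<longleftrightarrow> v0 ''y'' \<^bold>= \<^bold>0)"
      using c by (cases "holds (e(?x := a)) A") (auto intro: bexI[of _ zer] bexI[of _ un])
  qed (use A e in auto)
  then show ?thesis by (auto simp: c)
qed


section \<open>Semidecidable predicates on type 1\<close>

text \<open>Prefixing a number to a sequence is a case distinction on the argument, obtained from
  the recursor by a step that ignores the previous value.\<close>

lemma ex_cons:
  "\<exists>c\<in>dm (\<iota> \<rightarrow> (\<iota> \<rightarrow> \<iota>) \<rightarrow> \<iota> \<rightarrow> \<iota>). \<forall>i\<in>N. \<forall>w\<in>dm (\<iota> \<rightarrow> \<iota>).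
     c \<bullet> i \<bullet> w \<bullet> zer = i \<and> (\<forall>n\<in>N. c \<bullet> i \<bullet> w \<bullet> add n un = w \<bullet> n)"
proof -
  obtain e0 where e0: "valuation dm e0" using ex_val by blast
  let ?s = "lam ''j'' \<iota> (lam ''r'' \<iota> (v1 ''w'' \<cdot> v0 ''j''))"
  obtain c where c: "c \<in> dm (\<iota> \<rightarrow> (\<iota> \<rightarrow> \<iota>) \<rightarrow> \<iota> \<rightarrow> \<iota>)"
    and ceq: "\<And>i w. i \<in> N \<Longrightarrow> w \<in> dm (\<iota> \<rightarrow> \<iota>) \<Longrightarrow>
      c \<bullet> i \<bullet> w = ev (e0((''i'', \<iota>) := i, (''w'', \<iota> \<rightarrow> \<iota>) := w)) (Con CRec \<cdot> ?s \<cdot> v0 ''i'')"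
    using abstraction2[OF e0, of "Con CRec \<cdot> ?s \<cdot> v0 ''i''" "\<iota> \<rightarrow> \<iota>" \<iota> "\<iota> \<rightarrow> \<iota>" "''i''" "''w''"] by auto
  have "c \<bullet> i \<bullet> w \<bullet> zer = i \<and> (\<forall>n\<in>N. c \<bullet> i \<bullet> w \<bullet> add n un = w \<bullet> n)"
    if i: "i \<in> N" and w: "w \<in> dm (\<iota> \<rightarrow> \<iota>)" for i w
  proof -
    let ?e = "e0((''i'', \<iota>) := i, (''w'', \<iota> \<rightarrow> \<iota>) := w)"
    have e: "valuation dm ?e" using e0 i w by simp
    have f: "ev ?e ?s \<in> dm (\<iota> \<rightarrow> \<iota> \<rightarrow> \<iota>)" using ev_in[OF e, of ?s] by simp
    have "ev ?e ?s \<bullet> n \<bullet> r = w \<bullet> n" if "n \<in> N" "r \<in> N" for n r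
      using that e by (simp add: beta)
    moreover have "con CRec \<bullet> ev ?e ?s \<bullet> i \<bullet> n \<in> N" if "n \<in> N" for n
      using that f i by (meson app_in rec_in)
    ultimately show ?thesis using i w f by (simp add: ceq rec_zer rec_suc)
  qed
  then show ?thesis using c by blast
qed

lemma ex_tail:
  "\<exists>c\<in>dm ((\<iota> \<rightarrow> \<iota>) \<rightarrow> \<iota> \<rightarrow> \<iota>). \<forall>w\<in>dm (\<iota> \<rightarrow> \<iota>). \<forall>n\<in>N. c \<bullet> w \<bullet> n = w \<bullet> add n un"
proof -
  obtain e0 where e0: "valuation dm e0" using ex_val by blast
  show ?thesis
    using abstraction2[OF e0, of "v1 ''w'' \<cdot> (v0 ''n'' \<oplus> \<^bold>1)" \<iota> "\<iota> \<rightarrow> \<iota>" \<iota> "''w''" "''n''"] by simp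
qed

text \<open>Bounded search: \<open>B \<bullet> f \<bullet> m\<close> is the product of \<open>f \<bullet> i\<close> over \<open>i < m\<close>.\<close>

lemma ex_search:
  "\<exists>B\<in>dm ((\<iota> \<rightarrow> \<iota>) \<rightarrow> \<iota> \<rightarrow> \<iota>). \<forall>f\<in>dm (\<iota> \<rightarrow> \<iota>).
     (\<forall>m\<in>N. B \<bullet> f \<bullet> m = zer \<longrightarrow> (\<exists>i\<in>N. f \<bullet> i = zer)) \<and>
     (\<forall>i\<in>N. \<forall>m\<in>N. f \<bullet> i = zer \<longrightarrow> B \<bullet> f \<bullet> add (add i un) m = zer)"
proof -
  obtain e0 where e0: "valuation dm e0" using ex_val by blast
  let ?s = "lam ''i'' \<iota> (lam ''r'' \<iota> (v0 ''r'' \<otimes> v1 ''f'' \<cdot> v0 ''i''))"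
  obtain B where B: "B \<in> dm ((\<iota> \<rightarrow> \<iota>) \<rightarrow> \<iota> \<rightarrow> \<iota>)"
    and Beq: "\<And>f. f \<in> dm (\<iota> \<rightarrow> \<iota>) \<Longrightarrow> B \<bullet> f = ev (e0((''f'', \<iota> \<rightarrow> \<iota>) := f)) (Con CRec \<cdot> ?s \<cdot> \<^bold>1)"
    using abstraction[OF e0, of "Con CRec \<cdot> ?s \<cdot> \<^bold>1" "\<iota> \<rightarrow> \<iota>" "\<iota> \<rightarrow> \<iota>" "''f''"] by auto
  have "(\<forall>m\<in>N. B \<bullet> f \<bullet> m = zer \<longrightarrow> (\<exists>i\<in>N. f \<bullet> i = zer)) \<and>
     (\<forall>i\<in>N. \<forall>m\<in>N. f \<bullet> i = zer \<longrightarrow> B \<bullet> f \<bullet> add (add i un) m = zer)"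
    if f: "f \<in> dm (\<iota> \<rightarrow> \<iota>)" for f
  proof -
    let ?e = "e0((''f'', \<iota> \<rightarrow> \<iota>) := f)"
    have e: "valuation dm ?e" using e0 f by simp
    have s: "ev ?e ?s \<in> dm (\<iota> \<rightarrow> \<iota> \<rightarrow> \<iota>)" using ev_in[OF e, of ?s] by simp
    have Bf: "B \<bullet> f \<in> dm (\<iota> \<rightarrow> \<iota>)" using B f by (rule app_in)
    then have BfN: "B \<bullet> f \<bullet> n \<in> N" and fN: "f \<bullet> n \<in> N" if "n \<in> N" for n
      using that f app_in by blast+
    have seq: "ev ?e ?s \<bullet> n \<bullet> r = mul r (f \<bullet> n)" if "n \<in> N" "r \<in> N" for n r
      using that e by (simp add: beta)
    have B0: "B \<bullet> f \<bullet> zer = un" using s f by (simp add: Beq rec_zer)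
    have BS: "B \<bullet> f \<bullet> add n un = mul (B \<bullet> f \<bullet> n) (f \<bullet> n)" if n: "n \<in> N" for n
    proof -
      have "B \<bullet> f \<bullet> add n un = ev ?e ?s \<bullet> n \<bullet> (B \<bullet> f \<bullet> n)"
        using s n f by (simp add: Beq rec_suc)
      then show ?thesis using seq[OF n BfN[OF n]] by simp
    qed
    \<comment> \<open>By contraposition: a product of nonzero factors stays nonzero, which is the
      form accepted by \<open>induct_neq_zer\<close>.\<close>
    have "\<exists>i\<in>N. f \<bullet> i = zer" if m: "m \<in> N" "B \<bullet> f \<bullet> m = zer" for m
    proof (rule ccontr)
      assume "\<not> (\<exists>i\<in>N. f \<bullet> i = zer)"
      then have "B \<bullet> f \<bullet> m \<noteq> zer"
        by (intro induct_neq_zer[OF Bf _ _ m(1)]) (auto simp: B0 BS mul_eq_zer BfN fN)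
      then show False using m by simp
    qed
    moreover have "B \<bullet> f \<bullet> add (add i un) m = zer"
      if i: "i \<in> N" "f \<bullet> i = zer" and m: "m \<in> N" for i m
    proof -
      let ?e' = "e0((''b'', \<iota> \<rightarrow> \<iota>) := B \<bullet> f, (''i'', \<iota>) := i)"
      \<comment> \<open>The search is shifted by \<open>i + 1\<close>, the first bound that covers
        the zero \<open>i\<close>, so that the induction can start at 0.\<close>
      obtain g where g: "g \<in> dm (\<iota> \<rightarrow> \<iota>)" and geq: "\<And>m. m \<in> N \<Longrightarrow> g \<bullet> m = B \<bullet> f \<bullet> add (add i un) m"
        using abstraction[of ?e' "v1 ''b'' \<cdot> ((v0 ''i'' \<oplus> \<^bold>1) \<oplus> v0 ''m'')" \<iota> \<iota> "''m''"] e0 Bf i by auto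
      have "g \<bullet> m = zer"
      proof (rule induct_eq_zer[OF g _ _ m])
        show "g \<bullet> zer = zer" using i by (simp add: geq add_zer BS mul_eq_zer BfN fN)
        fix n assume n: "n \<in> N" "g \<bullet> n = zer"
        have "add (add i un) (add n un) = add (add (add i un) n) un"
          using i n by (intro add_assoc[symmetric]) auto
        then show "g \<bullet> add n un = zer" using n i by (simp add: geq BS mul_eq_zer BfN fN)
      qed
      then show ?thesis using m by (simp add: geq)
    qed
    ultimately show ?thesis by blast
  qed
  then show ?thesis using B by blast
qed

section \<open>Closure properties of semidecidable predicates\<close>

definition decidable :: "('m \<Rightarrow> bool) \<Rightarrow> bool" where
  "decidable P \<longleftrightarrow> (\<exists>C\<in>dm ((\<iota> \<rightarrow> \<iota>) \<rightarrow> \<iota>). \<forall>w\<in>dm (\<iota> \<rightarrow> \<iota>). P w \<longleftrightarrow> C \<bullet> w = zer)"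

definition semidecidable :: "('m \<Rightarrow> bool) \<Rightarrow> bool" where
  "semidecidable P \<longleftrightarrow> (\<exists>C\<in>dm ((\<iota> \<rightarrow> \<iota>) \<rightarrow> \<iota> \<rightarrow> \<iota>).
     \<forall>w\<in>dm (\<iota> \<rightarrow> \<iota>). P w \<longleftrightarrow> (\<exists>m\<in>N. C \<bullet> w \<bullet> m = zer))"

lemma decidable_semidecidable:
  assumes "decidable P"
  shows "semidecidable P"
proof -
  obtain e0 where e0: "valuation dm e0" using ex_val by blast
  obtain C where C: "C \<in> dm ((\<iota> \<rightarrow> \<iota>) \<rightarrow> \<iota>)" "\<forall>w\<in>dm (\<iota> \<rightarrow> \<iota>). P w \<longleftrightarrow> C \<bullet> w = zer"
    using assms unfolding decidable_def by blast
  obtain C' where "C' \<in> dm ((\<iota> \<rightarrow> \<iota>) \<rightarrow> \<iota> \<rightarrow> \<iota>)"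
    "\<forall>w\<in>dm (\<iota> \<rightarrow> \<iota>). \<forall>m\<in>N. C' \<bullet> w \<bullet> m = C \<bullet> w"
    using abstraction2[of "e0((''C'', (\<iota> \<rightarrow> \<iota>) \<rightarrow> \<iota>) := C)" "v2 ''C'' \<cdot> v1 ''w''" \<iota> "\<iota> \<rightarrow> \<iota>" \<iota> "''w''" "''m''"]
      e0 C by auto
  then show ?thesis unfolding semidecidable_def using C by (intro bexI[of _ C']) (auto intro: exI[of _ zer])
qed

text \<open>The quantifier over \<open>i\<close> and the one hidden in \<open>P\<close> are both
  bounded by a single \<open>m\<close>: the new test is a product over \<open>i < m\<close> of
  products over \<open>j < m\<close>, which vanishes if and only if suitable \<open>i\<close> and
  \<open>j\<close> exist below \<open>m\<close>.\<close>

lemma semidecidable_Ex: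
  assumes P: "semidecidable P"
    and c: "c \<in> dm (\<iota> \<rightarrow> (\<iota> \<rightarrow> \<iota>) \<rightarrow> \<iota> \<rightarrow> \<iota>)"
  shows "semidecidable (\<lambda>w. \<exists>i\<in>N. P (c \<bullet> i \<bullet> w))"
proof -
  obtain e0 where e0: "valuation dm e0" using ex_val by blast
  obtain C where C: "C \<in> dm ((\<iota> \<rightarrow> \<iota>) \<rightarrow> \<iota> \<rightarrow> \<iota>)"
    and CP: "\<And>w. w \<in> dm (\<iota> \<rightarrow> \<iota>) \<Longrightarrow> P w \<longleftrightarrow> (\<exists>m\<in>N. C \<bullet> w \<bullet> m = zer)"
    using P unfolding semidecidable_def by blast
  obtain B where B: "B \<in> dm ((\<iota> \<rightarrow> \<iota>) \<rightarrow> \<iota> \<rightarrow> \<iota>)"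
    and B1: "\<And>f m. f \<in> dm (\<iota> \<rightarrow> \<iota>) \<Longrightarrow> m \<in> N \<Longrightarrow> B \<bullet> f \<bullet> m = zer \<Longrightarrow> \<exists>i\<in>N. f \<bullet> i = zer"
    and B2: "\<And>f i m. f \<in> dm (\<iota> \<rightarrow> \<iota>) \<Longrightarrow> i \<in> N \<Longrightarrow> m \<in> N \<Longrightarrow> f \<bullet> i = zer \<Longrightarrow>
      B \<bullet> f \<bullet> add (add i un) m = zer"
    using ex_search by blast
  let ?TC = "(\<iota> \<rightarrow> \<iota>) \<rightarrow> \<iota> \<rightarrow> \<iota>" and ?Tc = "\<iota> \<rightarrow> (\<iota> \<rightarrow> \<iota>) \<rightarrow> \<iota> \<rightarrow> \<iota>"
  let ?t1 = "lam ''j'' \<iota> (Var ''C'' ?TC \<cdot> (Var ''c'' ?Tc \<cdot> v0 ''i'' \<cdot> v1 ''w'') \<cdot> v0 ''j'')"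
  let ?t2 = "lam ''i'' \<iota> (Var ''B'' ?TC \<cdot> ?t1 \<cdot> v0 ''m'')"
  let ?e = "e0((''C'', ?TC) := C, (''c'', ?Tc) := c, (''B'', ?TC) := B)"
  have e: "valuation dm ?e" using e0 B C c by simp
  obtain D where D: "D \<in> dm ?TC" and Deq: "\<And>w m. w \<in> dm (\<iota> \<rightarrow> \<iota>) \<Longrightarrow> m \<in> N \<Longrightarrow>
      D \<bullet> w \<bullet> m = ev (?e((''w'', \<iota> \<rightarrow> \<iota>) := w, (''m'', \<iota>) := m)) (Var ''B'' ?TC \<cdot> ?t2 \<cdot> v0 ''m'')"
    using abstraction2[OF e, of "Var ''B'' ?TC \<cdot> ?t2 \<cdot> v0 ''m''" \<iota> "\<iota> \<rightarrow> \<iota>" \<iota> "''w''" "''m''"] by auto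
  have "(\<exists>i\<in>N. P (c \<bullet> i \<bullet> w)) \<longleftrightarrow> (\<exists>m\<in>N. D \<bullet> w \<bullet> m = zer)" if w: "w \<in> dm (\<iota> \<rightarrow> \<iota>)" for w
  proof -
    have cw: "c \<bullet> i \<bullet> w \<in> dm (\<iota> \<rightarrow> \<iota>)" if "i \<in> N" for i
      using c w that by (meson app_in)
    have F: "\<exists>f2\<in>dm (\<iota> \<rightarrow> \<iota>). D \<bullet> w \<bullet> m = B \<bullet> f2 \<bullet> m \<and>
      (\<forall>i\<in>N. \<exists>f1\<in>dm (\<iota> \<rightarrow> \<iota>). f2 \<bullet> i = B \<bullet> f1 \<bullet> m \<and> (\<forall>j\<in>N. f1 \<bullet> j = C \<bullet> (c \<bullet> i \<bullet> w) \<bullet> j))"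
      if m: "m \<in> N" for m
    proof -
      let ?e' = "?e((''w'', \<iota> \<rightarrow> \<iota>) := w, (''m'', \<iota>) := m)"
      have e': "valuation dm ?e'" by (rule valuation_upd[OF valuation_upd[OF e w] m])
      have "ev ?e' ?t2 \<in> dm (\<iota> \<rightarrow> \<iota>)" using ev_in[OF e', of ?t2] by simp
      moreover have "D \<bullet> w \<bullet> m = B \<bullet> ev ?e' ?t2 \<bullet> m" using Deq[OF w m] by simp
      moreover have "\<exists>f1\<in>dm (\<iota> \<rightarrow> \<iota>). ev ?e' ?t2 \<bullet> i = B \<bullet> f1 \<bullet> m \<and>
          (\<forall>j\<in>N. f1 \<bullet> j = C \<bullet> (c \<bullet> i \<bullet> w) \<bullet> j)" if i: "i \<in> N" for i
      proof -
        let ?e'' = "?e'((''i'', \<iota>) := i)"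
        have e'': "valuation dm ?e''" by (rule valuation_upd[OF e' i])
        have "ev ?e'' ?t1 \<in> dm (\<iota> \<rightarrow> \<iota>)" using ev_in[OF e'', of ?t1] by simp
        moreover have "ev ?e' ?t2 \<bullet> i = B \<bullet> ev ?e'' ?t1 \<bullet> m"
          using beta[OF e', of "Var ''B'' ?TC \<cdot> ?t1 \<cdot> v0 ''m''" i \<iota> "''i''"] i by simp
        moreover have "ev ?e'' ?t1 \<bullet> j = C \<bullet> (c \<bullet> i \<bullet> w) \<bullet> j" if "j \<in> N" for j
          using beta[OF e'', of "Var ''C'' ?TC \<cdot> (Var ''c'' ?Tc \<cdot> v0 ''i'' \<cdot> v1 ''w'') \<cdot> v0 ''j''" j \<iota> "''j''"]
            that by simp
        ultimately show ?thesis by blast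
      qed
      ultimately show ?thesis by blast
    qed
    show ?thesis
    proof
      assume "\<exists>i\<in>N. P (c \<bullet> i \<bullet> w)"
      then obtain i j where ij: "i \<in> N" "j \<in> N" "C \<bullet> (c \<bullet> i \<bullet> w) \<bullet> j = zer" using CP cw by blast
      \<comment> \<open>This bound exceeds both \<open>i\<close> and \<open>j\<close>; by
        commutativity it has the shape demanded by \<open>B2\<close> for either of them.\<close>
      let ?m = "add (add i un) (add j un)"
      have m: "?m \<in> N" "?m = add (add j un) (add i un)" using ij by (auto intro: add_comm)
      obtain f2 where f2: "f2 \<in> dm (\<iota> \<rightarrow> \<iota>)" "D \<bullet> w \<bullet> ?m = B \<bullet> f2 \<bullet> ?m"
        and "\<exists>f1\<in>dm (\<iota> \<rightarrow> \<iota>). f2 \<bullet> i = B \<bullet> f1 \<bullet> ?m \<and> (\<forall>j\<in>N. f1 \<bullet> j = C \<bullet> (c \<bullet> i \<bullet> w) \<bullet> j)"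
        using F[OF m(1)] ij(1) by blast
      then obtain f1 where f1: "f1 \<in> dm (\<iota> \<rightarrow> \<iota>)" "f2 \<bullet> i = B \<bullet> f1 \<bullet> ?m" "f1 \<bullet> j = zer"
        using ij by auto
      have "B \<bullet> f1 \<bullet> ?m = zer" unfolding m(2) by (rule B2) (use f1 ij in auto)
      then have "B \<bullet> f2 \<bullet> ?m = zer" by (intro B2) (use f1 f2 ij in auto)
      then show "\<exists>m\<in>N. D \<bullet> w \<bullet> m = zer" using f2 m(1) by auto
    next
      assume "\<exists>m\<in>N. D \<bullet> w \<bullet> m = zer"
      then obtain m where m: "m \<in> N" "D \<bullet> w \<bullet> m = zer" by blast
      obtain f2 where f2: "f2 \<in> dm (\<iota> \<rightarrow> \<iota>)" "B \<bullet> f2 \<bullet> m = zer"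
        and *: "\<And>i. i \<in> N \<Longrightarrow> \<exists>f1\<in>dm (\<iota> \<rightarrow> \<iota>). f2 \<bullet> i = B \<bullet> f1 \<bullet> m \<and> (\<forall>j\<in>N. f1 \<bullet> j = C \<bullet> (c \<bullet> i \<bullet> w) \<bullet> j)"
        using F[OF m(1)] m(2) by auto
      obtain i where i: "i \<in> N" "f2 \<bullet> i = zer" using B1[OF f2(1) m(1) f2(2)] by blast
      obtain f1 where f1: "f1 \<in> dm (\<iota> \<rightarrow> \<iota>)" "B \<bullet> f1 \<bullet> m = zer" "\<And>j. j \<in> N \<Longrightarrow> f1 \<bullet> j = C \<bullet> (c \<bullet> i \<bullet> w) \<bullet> j"
        using *[OF i(1)] i(2) by auto
      obtain j where "j \<in> N" "f1 \<bullet> j = zer" using B1[OF f1(1) m(1) f1(2)] by blast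
      then show "\<exists>i\<in>N. P (c \<bullet> i \<bullet> w)" using f1(3) i(1) CP cw by metis
    qed
  qed
  then show ?thesis unfolding semidecidable_def using D by blast
qed

text \<open>A sum vanishes only if both summands do. The two tests are first replaced by bounded
  searches, because these keep succeeding for larger bounds and so admit a common witness.\<close>

lemma semidecidable_And:
  assumes "semidecidable P" "semidecidable Q"
  shows "semidecidable (\<lambda>w. P w \<and> Q w)"
proof -
  obtain e0 where e0: "valuation dm e0" using ex_val by blast
  obtain C1 C2 where C: "C1 \<in> dm ((\<iota> \<rightarrow> \<iota>) \<rightarrow> \<iota> \<rightarrow> \<iota>)" "C2 \<in> dm ((\<iota> \<rightarrow> \<iota>) \<rightarrow> \<iota> \<rightarrow> \<iota>)"
    and CP: "\<And>w. w \<in> dm (\<iota> \<rightarrow> \<iota>) \<Longrightarrow> P w \<longleftrightarrow> (\<exists>m\<in>N. C1 \<bullet> w \<bullet> m = zer)"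
      "\<And>w. w \<in> dm (\<iota> \<rightarrow> \<iota>) \<Longrightarrow> Q w \<longleftrightarrow> (\<exists>m\<in>N. C2 \<bullet> w \<bullet> m = zer)"
    using assms unfolding semidecidable_def by blast
  obtain B where B: "B \<in> dm ((\<iota> \<rightarrow> \<iota>) \<rightarrow> \<iota> \<rightarrow> \<iota>)"
    and B1: "\<And>f m. f \<in> dm (\<iota> \<rightarrow> \<iota>) \<Longrightarrow> m \<in> N \<Longrightarrow> B \<bullet> f \<bullet> m = zer \<Longrightarrow> \<exists>i\<in>N. f \<bullet> i = zer"
    and B2: "\<And>f i m. f \<in> dm (\<iota> \<rightarrow> \<iota>) \<Longrightarrow> i \<in> N \<Longrightarrow> m \<in> N \<Longrightarrow> f \<bullet> i = zer \<Longrightarrow>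
      B \<bullet> f \<bullet> add (add i un) m = zer"
    using ex_search by blast
  let ?TC = "(\<iota> \<rightarrow> \<iota>) \<rightarrow> \<iota> \<rightarrow> \<iota>"
  let ?e = "e0((''C1'', ?TC) := C1, (''C2'', ?TC) := C2, (''B'', ?TC) := B)"
  let ?B = "\<lambda>c. Var ''B'' ?TC \<cdot> (Var c ?TC \<cdot> v1 ''w'') \<cdot> v0 ''m''"
  obtain D where D: "D \<in> dm ?TC" and Deq: "\<And>w m. w \<in> dm (\<iota> \<rightarrow> \<iota>) \<Longrightarrow> m \<in> N \<Longrightarrow>
      D \<bullet> w \<bullet> m = add (B \<bullet> (C1 \<bullet> w) \<bullet> m) (B \<bullet> (C2 \<bullet> w) \<bullet> m)"
    using abstraction2[of ?e "?B ''C1'' \<oplus> ?B ''C2''" \<iota> "\<iota> \<rightarrow> \<iota>" \<iota> "''w''" "''m''"] e0 B C by auto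
  have "P w \<and> Q w \<longleftrightarrow> (\<exists>m\<in>N. D \<bullet> w \<bullet> m = zer)" if w: "w \<in> dm (\<iota> \<rightarrow> \<iota>)" for w
  proof -
    have Cw: "C1 \<bullet> w \<in> dm (\<iota> \<rightarrow> \<iota>)" "C2 \<bullet> w \<in> dm (\<iota> \<rightarrow> \<iota>)" using C w app_in by blast+
    then have BN: "B \<bullet> (C1 \<bullet> w) \<bullet> m \<in> N" "B \<bullet> (C2 \<bullet> w) \<bullet> m \<in> N" if "m \<in> N" for m
      using that B by (meson app_in)+
    have D0: "D \<bullet> w \<bullet> m = zer \<longleftrightarrow> B \<bullet> (C1 \<bullet> w) \<bullet> m = zer \<and> B \<bullet> (C2 \<bullet> w) \<bullet> m = zer" if "m \<in> N" for m
      using that w BN by (simp add: Deq add_eq_zer)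
    show ?thesis
    proof
      assume "P w \<and> Q w"
      then obtain i j where ij: "i \<in> N" "C1 \<bullet> w \<bullet> i = zer" "j \<in> N" "C2 \<bullet> w \<bullet> j = zer"
        using CP w by blast
      let ?m = "add (add i un) (add j un)"
      have m: "?m \<in> N" "?m = add (add j un) (add i un)" using ij by (auto intro: add_comm)
      have "B \<bullet> (C1 \<bullet> w) \<bullet> ?m = zer" by (intro B2) (use ij Cw in auto)
      moreover have "B \<bullet> (C2 \<bullet> w) \<bullet> ?m = zer" unfolding m(2) by (intro B2) (use ij Cw in auto)
      ultimately show "\<exists>m\<in>N. D \<bullet> w \<bullet> m = zer" using D0 m(1) by blast
    next
      assume "\<exists>m\<in>N. D \<bullet> w \<bullet> m = zer"
      then show "P w \<and> Q w" using D0 B1 Cw CP w by blast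
    qed
  qed
  then show ?thesis unfolding semidecidable_def using D by blast
qed

text \<open>A family of valuations each of whose values depends on \<open>w\<close> through an element of the model. In
  the passage through an existential quantifier the quantified number becomes the first entry
  of \<open>w\<close>.\<close>

definition family :: "('m \<Rightarrow> string \<times> ty \<Rightarrow> 'm) \<Rightarrow> bool" where
  "family E \<longleftrightarrow> (\<forall>x \<sigma>. \<exists>f\<in>dm ((\<iota> \<rightarrow> \<iota>) \<rightarrow> \<sigma>). \<forall>w\<in>dm (\<iota> \<rightarrow> \<iota>). f \<bullet> w = E w (x, \<sigma>))"

lemma family_tm:
  assumes E: "family E" and t: "wt t"
  shows "\<exists>f\<in>dm ((\<iota> \<rightarrow> \<iota>) \<rightarrow> ty_of t). \<forall>w\<in>dm (\<iota> \<rightarrow> \<iota>). f \<bullet> w = ev (E w) t"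
proof -
  obtain e0 where e0: "valuation dm e0" using ex_val by blast
  show ?thesis using t
  proof (induction t)
    case (Var x \<sigma>)
    then show ?case using E by (simp add: family_def)
  next
    case (Con c)
    show ?case using abstraction[OF e0, of "Con c" "const_ty c" "\<iota> \<rightarrow> \<iota>" "''w''"] by simp
  next
    case (App s t)
    obtain \<tau> where *: "wt s" "wt t" "ty_of s = ty_of t \<rightarrow> \<tau>" "ty_of (s \<cdot> t) = \<tau>"
      using App.prems by auto
    obtain f g where f: "f \<in> dm ((\<iota> \<rightarrow> \<iota>) \<rightarrow> ty_of t \<rightarrow> \<tau>)" "\<forall>w\<in>dm (\<iota> \<rightarrow> \<iota>). f \<bullet> w = ev (E w) s"
      and g: "g \<in> dm ((\<iota> \<rightarrow> \<iota>) \<rightarrow> ty_of t)" "\<forall>w\<in>dm (\<iota> \<rightarrow> \<iota>). g \<bullet> w = ev (E w) t"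
      using App.IH * by auto
    let ?Tf = "(\<iota> \<rightarrow> \<iota>) \<rightarrow> ty_of t \<rightarrow> \<tau>" and ?Tg = "(\<iota> \<rightarrow> \<iota>) \<rightarrow> ty_of t"
    show ?case unfolding *(4)
      using abstraction[of "e0((''f'', ?Tf) := f, (''g'', ?Tg) := g)"
          "Var ''f'' ?Tf \<cdot> v1 ''w'' \<cdot> (Var ''g'' ?Tg \<cdot> v1 ''w'')" \<tau> "\<iota> \<rightarrow> \<iota>" "''w''"] e0 f g
      by auto
  qed
qed

text \<open>A family may vary all variables at once, whereas \<open>qf_characteristic\<close> varies
  only \<open>x\<close>. Terms and subformulas are therefore replaced by functionals of
  \<open>w\<close>, and each prime formula or connective is treated as a formula in \<open>x\<close>
  with these functionals as parameters.\<close>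

lemma family_qf: "qf A \<Longrightarrow> wf_fm A \<Longrightarrow> family E \<Longrightarrow> decidable (\<lambda>w. holds (E w) A)"
proof (induction A)
  case (Eq s t)
  obtain e0 where e0: "valuation dm e0" using ex_val by blast
  obtain f g where f: "f \<in> dm ((\<iota> \<rightarrow> \<iota>) \<rightarrow> \<iota>)" "\<forall>w\<in>dm (\<iota> \<rightarrow> \<iota>). f \<bullet> w = ev (E w) s"
    and g: "g \<in> dm ((\<iota> \<rightarrow> \<iota>) \<rightarrow> \<iota>)" "\<forall>w\<in>dm (\<iota> \<rightarrow> \<iota>). g \<bullet> w = ev (E w) t"
    using family_tm[of E s] family_tm[of E t] Eq by auto
  show ?case
    using qf_characteristic[of "v2 ''f'' \<cdot> v1 ''x'' \<^bold>= v2 ''g'' \<cdot> v1 ''x''"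
        "e0((''f'', (\<iota> \<rightarrow> \<iota>) \<rightarrow> \<iota>) := f, (''g'', (\<iota> \<rightarrow> \<iota>) \<rightarrow> \<iota>) := g)"] e0 f g
    by (simp add: decidable_def)
next
  case (Less s t)
  obtain e0 where e0: "valuation dm e0" using ex_val by blast
  obtain f g where f: "f \<in> dm ((\<iota> \<rightarrow> \<iota>) \<rightarrow> \<iota>)" "\<forall>w\<in>dm (\<iota> \<rightarrow> \<iota>). f \<bullet> w = ev (E w) s"
    and g: "g \<in> dm ((\<iota> \<rightarrow> \<iota>) \<rightarrow> \<iota>)" "\<forall>w\<in>dm (\<iota> \<rightarrow> \<iota>). g \<bullet> w = ev (E w) t"
    using family_tm[of E s] family_tm[of E t] Less by auto
  show ?case
    using qf_characteristic[of "v2 ''f'' \<cdot> v1 ''x'' \<^bold>< v2 ''g'' \<cdot> v1 ''x''"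
        "e0((''f'', (\<iota> \<rightarrow> \<iota>) \<rightarrow> \<iota>) := f, (''g'', (\<iota> \<rightarrow> \<iota>) \<rightarrow> \<iota>) := g)"] e0 f g
    by (simp add: decidable_def)
next
  case Fls
  obtain e0 where "valuation dm e0" using ex_val by blast
  then show ?case using qf_characteristic[of Fls e0] by (simp add: decidable_def)
next
  case (Imp A B)
  obtain e0 where e0: "valuation dm e0" using ex_val by blast
  obtain f g where f: "f \<in> dm ((\<iota> \<rightarrow> \<iota>) \<rightarrow> \<iota>)" "\<forall>w\<in>dm (\<iota> \<rightarrow> \<iota>). holds (E w) A \<longleftrightarrow> f \<bullet> w = zer"
    and g: "g \<in> dm ((\<iota> \<rightarrow> \<iota>) \<rightarrow> \<iota>)" "\<forall>w\<in>dm (\<iota> \<rightarrow> \<iota>). holds (E w) B \<longleftrightarrow> g \<bullet> w = zer"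
    using Imp by (auto simp: decidable_def)
  show ?case
    using qf_characteristic[of "v2 ''f'' \<cdot> v1 ''x'' \<^bold>= \<^bold>0 \<^bold>\<longrightarrow> v2 ''g'' \<cdot> v1 ''x'' \<^bold>= \<^bold>0"
        "e0((''f'', (\<iota> \<rightarrow> \<iota>) \<rightarrow> \<iota>) := f, (''g'', (\<iota> \<rightarrow> \<iota>) \<rightarrow> \<iota>) := g)"] e0 f g
    by (simp add: decidable_def)
next
  case (All x \<sigma> A)
  then show ?case by simp
qed

lemma family_sigma1:
  "sigma1 A \<Longrightarrow> wf_fm A \<Longrightarrow> family E \<Longrightarrow> semidecidable (\<lambda>w. holds (E w) A)"
proof (induction A arbitrary: E rule: sigma1.induct)
  case (qf A)
  then show ?case by (intro decidable_semidecidable family_qf)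
next
  case (And A B)
  then show ?case using semidecidable_And by simp
next
  case (Ex A y)
  obtain e0 where e0: "valuation dm e0" using ex_val by blast
  obtain c where c: "c \<in> dm (\<iota> \<rightarrow> (\<iota> \<rightarrow> \<iota>) \<rightarrow> \<iota> \<rightarrow> \<iota>)"
    and c0: "\<And>i w. i \<in> N \<Longrightarrow> w \<in> dm (\<iota> \<rightarrow> \<iota>) \<Longrightarrow> c \<bullet> i \<bullet> w \<bullet> zer = i"
    and cS: "\<And>i w n. i \<in> N \<Longrightarrow> w \<in> dm (\<iota> \<rightarrow> \<iota>) \<Longrightarrow> n \<in> N \<Longrightarrow> c \<bullet> i \<bullet> w \<bullet> add n un = w \<bullet> n"
    using ex_cons by blast
  obtain d where d: "d \<in> dm ((\<iota> \<rightarrow> \<iota>) \<rightarrow> \<iota> \<rightarrow> \<iota>)"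
    and dn: "\<And>w n. w \<in> dm (\<iota> \<rightarrow> \<iota>) \<Longrightarrow> n \<in> N \<Longrightarrow> d \<bullet> w \<bullet> n = w \<bullet> add n un"
    using ex_tail by blast
  have cw: "c \<bullet> i \<bullet> w \<in> dm (\<iota> \<rightarrow> \<iota>)" if "i \<in> N" "w \<in> dm (\<iota> \<rightarrow> \<iota>)" for i w
    using c that by (meson app_in)
  have dw: "d \<bullet> w \<in> dm (\<iota> \<rightarrow> \<iota>)" if "w \<in> dm (\<iota> \<rightarrow> \<iota>)" for w
    using d that by (rule app_in)
  \<comment> \<open>Identity is required here, not mere agreement of entries, since \<open>E\<close>
    is an arbitrary function on the carrier.\<close>
  have dc: "d \<bullet> (c \<bullet> i \<bullet> w) = w" if "i \<in> N" "w \<in> dm (\<iota> \<rightarrow> \<iota>)" for i w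
    by (rule app_ext[of _ \<iota> \<iota>]) (use that cw dw in \<open>auto simp: dn cS\<close>)
  let ?E = "\<lambda>w. (E (d \<bullet> w))((y, \<iota>) := w \<bullet> zer)"
  have "family ?E"
    unfolding family_def
  proof (intro allI)
    fix x \<sigma>
    show "\<exists>f\<in>dm ((\<iota> \<rightarrow> \<iota>) \<rightarrow> \<sigma>). \<forall>w\<in>dm (\<iota> \<rightarrow> \<iota>). f \<bullet> w = ?E w (x, \<sigma>)"
    proof (cases "(x, \<sigma>) = (y, \<iota>)")
      case True
      then show ?thesis
        using abstraction[OF e0, of "v1 ''w'' \<cdot> \<^bold>0" \<iota> "\<iota> \<rightarrow> \<iota>" "''w''"] by simp
    next
      case False
      obtain f where f: "f \<in> dm ((\<iota> \<rightarrow> \<iota>) \<rightarrow> \<sigma>)" "\<forall>w\<in>dm (\<iota> \<rightarrow> \<iota>). f \<bullet> w = E w (x, \<sigma>)"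
        using Ex.prems(2) unfolding family_def by blast
      let ?Tf = "(\<iota> \<rightarrow> \<iota>) \<rightarrow> \<sigma>" and ?Td = "(\<iota> \<rightarrow> \<iota>) \<rightarrow> \<iota> \<rightarrow> \<iota>"
      show ?thesis
        using abstraction[of "e0((''f'', ?Tf) := f, (''d'', ?Td) := d)"
            "Var ''f'' ?Tf \<cdot> (Var ''d'' ?Td \<cdot> v1 ''w'')" \<sigma> "\<iota> \<rightarrow> \<iota>" "''w''"] e0 f d dw False
        by auto
    qed
  qed
  then have "semidecidable (\<lambda>w. holds (?E w) A)" using Ex by simp
  from semidecidable_Ex[OF this c]
  show ?case by (simp add: semidecidable_def dc c0 cw cong: bex_cong)
qed

text \<open>\<open>Y\<close> chooses a number that witnesses one of the three predicates, and
  \<open>\<Phi>\<close> tests whether it witnesses \<open>P\<close>. The predicates may overlap; if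
  neither \<open>Q\<close> nor \<open>R\<close> holds, the chosen number can only be a witness for
  \<open>P\<close>.\<close>

lemma semidecidable_choice:
  assumes "semidecidable P" "semidecidable Q" "semidecidable R"
    and cover: "\<And>w. w \<in> dm (\<iota> \<rightarrow> \<iota>) \<Longrightarrow> P w \<or> Q w \<or> R w"
  shows "\<exists>\<Phi>\<in>dm ((\<iota> \<rightarrow> \<iota>) \<rightarrow> \<iota>). \<forall>w\<in>dm (\<iota> \<rightarrow> \<iota>). (\<Phi> \<bullet> w = zer \<longrightarrow> P w) \<and> (P w \<longrightarrow> Q w \<or> R w \<or> \<Phi> \<bullet> w = zer)"
proof -
  obtain e0 where e0: "valuation dm e0" using ex_val by blast
  let ?T = "(\<iota> \<rightarrow> \<iota>) \<rightarrow> \<iota> \<rightarrow> \<iota>" and ?x = "v1 ''x''" and ?y = "v0 ''y''"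
  obtain C1 where C1: "C1 \<in> dm ?T"
    and C1_iff: "\<And>w. w \<in> dm (\<iota> \<rightarrow> \<iota>) \<Longrightarrow> P w \<longleftrightarrow> (\<exists>m\<in>N. C1 \<bullet> w \<bullet> m = zer)"
    using assms(1) unfolding semidecidable_def by blast
  obtain C2 where C2: "C2 \<in> dm ?T"
    and C2_iff: "\<And>w. w \<in> dm (\<iota> \<rightarrow> \<iota>) \<Longrightarrow> Q w \<longleftrightarrow> (\<exists>m\<in>N. C2 \<bullet> w \<bullet> m = zer)"
    using assms(2) unfolding semidecidable_def by blast
  obtain C3 where C3: "C3 \<in> dm ?T"
    and C3_iff: "\<And>w. w \<in> dm (\<iota> \<rightarrow> \<iota>) \<Longrightarrow> R w \<longleftrightarrow> (\<exists>m\<in>N. C3 \<bullet> w \<bullet> m = zer)"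
    using assms(3) unfolding semidecidable_def by blast
  note C = C1 C2 C3 and CP = C1_iff C2_iff C3_iff
  let ?A = "\<lambda>c. Var c ?T \<cdot> ?x \<cdot> ?y \<^bold>= \<^bold>0"
  let ?e = "e0((''C1'', ?T) := C1, (''C2'', ?T) := C2, (''C3'', ?T) := C3)"
  have e: "valuation dm ?e" using e0 C by simp
  have "\<exists>Y\<in>dm ((\<iota> \<rightarrow> \<iota>) \<rightarrow> \<iota>). \<forall>w\<in>dm (\<iota> \<rightarrow> \<iota>).
      holds (?e((''x'', \<iota> \<rightarrow> \<iota>) := w, (''y'', \<iota>) := Y \<bullet> w)) (?A ''C1'' \<^bold>\<or> ?A ''C2'' \<^bold>\<or> ?A ''C3'')"
  proof (rule qf_choice[OF _ _ _ _ e])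
    fix w assume w: "w \<in> dm (\<iota> \<rightarrow> \<iota>)"
    then obtain m where "m \<in> N" "C1 \<bullet> w \<bullet> m = zer \<or> C2 \<bullet> w \<bullet> m = zer \<or> C3 \<bullet> w \<bullet> m = zer"
      using cover[OF w] CP by blast
    then show "\<exists>b\<in>N. holds (?e((''x'', \<iota> \<rightarrow> \<iota>) := w, (''y'', \<iota>) := b)) (?A ''C1'' \<^bold>\<or> ?A ''C2'' \<^bold>\<or> ?A ''C3'')"
      by auto
  qed auto
  then obtain Y where Y: "Y \<in> dm ((\<iota> \<rightarrow> \<iota>) \<rightarrow> \<iota>)"
    and YC: "\<And>w. w \<in> dm (\<iota> \<rightarrow> \<iota>) \<Longrightarrow>
      C1 \<bullet> w \<bullet> (Y \<bullet> w) = zer \<or> C2 \<bullet> w \<bullet> (Y \<bullet> w) = zer \<or> C3 \<bullet> w \<bullet> (Y \<bullet> w) = zer"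
    by auto
  \<comment> \<open>The chosen functional is passed under the name \<open>Z\<close>, as
    \<open>qf_characteristic\<close> reserves the name \<open>Y\<close> for its own use of
    choice.\<close>
  obtain \<Phi> where \<Phi>: "\<Phi> \<in> dm ((\<iota> \<rightarrow> \<iota>) \<rightarrow> \<iota>)"
    and \<Phi>C: "\<And>w. w \<in> dm (\<iota> \<rightarrow> \<iota>) \<Longrightarrow> C1 \<bullet> w \<bullet> (Y \<bullet> w) = zer \<longleftrightarrow> \<Phi> \<bullet> w = zer"
    using qf_characteristic[of "Var ''C1'' ?T \<cdot> ?x \<cdot> (v2 ''Z'' \<cdot> ?x) \<^bold>= \<^bold>0" "?e((''Z'', (\<iota> \<rightarrow> \<iota>) \<rightarrow> \<iota>) := Y)"]
      e Y by auto
  have YN: "Y \<bullet> w \<in> N" if "w \<in> dm (\<iota> \<rightarrow> \<iota>)" for w using Y that by (rule app_in)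
  have "(\<Phi> \<bullet> w = zer \<longrightarrow> P w) \<and> (P w \<longrightarrow> Q w \<or> R w \<or> \<Phi> \<bullet> w = zer)" if w: "w \<in> dm (\<iota> \<rightarrow> \<iota>)" for w
    using YC[OF w] \<Phi>C[OF w] CP[OF w] YN[OF w] by blast
  then show ?thesis using \<Phi> by blast
qed

end

section \<open>Free variables of the coding formulas\<close>

lemma fv_Exs_subset: "fv A \<subseteq> V \<union> set xs \<times> {\<iota>} \<Longrightarrow> fv (Exs xs A) \<subseteq> V"
  by (induction xs arbitrary: V) (auto simp: Exs_def)

lemma fv_Alls_subset: "fv A \<subseteq> V \<union> set xs \<times> {\<iota>} \<Longrightarrow> fv (Alls xs A) \<subseteq> V"
  by (induction xs arbitrary: V) (auto simp: Alls_def)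

lemma fv_Imp_subset: "fv A \<subseteq> V \<Longrightarrow> fv B \<subseteq> V \<Longrightarrow> fv (A \<^bold>\<longrightarrow> B) \<subseteq> V"
  by simp

lemma fv_And_subset: "fv A \<subseteq> V \<Longrightarrow> fv B \<subseteq> V \<Longrightarrow> fv (A \<^bold>\<and> B) \<subseteq> V"
  by simp

lemmas fv_subset = fv_Exs_subset fv_Alls_subset fv_And_subset fv_Imp_subset

lemma fv_rel:
  "fv_tm \<Phi> \<union> fv_tm a \<union> fv_tm p \<union> fv_tm q \<union> fv_tm b \<union> fv_tm u \<union> fv_tm v \<subseteq> V \<Longrightarrow>
     fv (rel \<Phi> a p q b u v) \<subseteq> V"
  unfolding rel_def Let_def
  by (intro fv_subset) (auto simp: posrat_def pair_def)

lemma fv_d_add_less: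
  "fv_tm x \<union> fv_tm y \<union> fv_tm p' \<union> fv_tm q' \<union> fv_tm p \<union> fv_tm q \<subseteq> V \<Longrightarrow>
     fv (d_add_less x y p' q' p q) \<subseteq> V"
  unfolding d_add_less_def by auto

lemma fv_is_code: "fv (is_code \<Phi>) \<subseteq> fv_tm \<Phi>"
  unfolding is_code_def Let_def
  by (intro fv_subset fv_rel fv_d_add_less)
    (simp_all add: dN_le_add_def dN_add_less_def posrat_def, blast+)

lemma fv_defined_at: "fv (defined_at \<Phi> x) \<subseteq> fv_tm \<Phi> \<union> fv_tm x"
  unfolding defined_at_def d_less_def Let_def
  by (intro fv_subset fv_rel fv_d_add_less) (simp_all, blast+)

lemma fv_in_cantor: "fv (in_cantor x) \<subseteq> fv_tm x"
  by (auto simp: in_cantor_def)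

lemma fv_in_closed: "fv (in_closed x D) \<subseteq> fv_tm x \<union> fv_tm D"
  by (auto simp: in_closed_def)

section \<open>The decision functional in a model\<close>

context RCA_model
begin

lemma holds_decidability:
  assumes e: "valuation dm e" and D: "D \<in> dm (\<iota> \<rightarrow> \<iota>)" and F: "F \<in> dm (\<iota> \<rightarrow> \<iota>)"
    and exact: "\<And>w. w \<in> dm (\<iota> \<rightarrow> \<iota>) \<Longrightarrow>
      holds (e((''D'', \<iota> \<rightarrow> \<iota>) := D, (''F'', \<iota> \<rightarrow> \<iota>) := F, (''x'', \<iota> \<rightarrow> \<iota>) := w))
        (in_cantor (v1 ''x'') \<^bold>\<longrightarrow>
          (in_closed (v1 ''x'') (v1 ''D'') \<^bold>\<longleftrightarrow> defined_at (v1 ''F'') (v1 ''x'')))"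
  shows "\<exists>\<Phi>\<in>dm ((\<iota> \<rightarrow> \<iota>) \<rightarrow> \<iota>). \<forall>w\<in>dm (\<iota> \<rightarrow> \<iota>).
    holds (e((''D'', \<iota> \<rightarrow> \<iota>) := D, (''F'', \<iota> \<rightarrow> \<iota>) := F, (''x'', \<iota> \<rightarrow> \<iota>) := w)) (in_cantor (v1 ''x'')) \<longrightarrow>
    (holds (e((''D'', \<iota> \<rightarrow> \<iota>) := D, (''F'', \<iota> \<rightarrow> \<iota>) := F, (''x'', \<iota> \<rightarrow> \<iota>) := w))
       (in_closed (v1 ''x'') (v1 ''D'')) \<longleftrightarrow> \<Phi> \<bullet> w = zer)"
proof -
  let ?e = "e((''D'', \<iota> \<rightarrow> \<iota>) := D, (''F'', \<iota> \<rightarrow> \<iota>) := F)"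
  let ?E = "\<lambda>w. ?e((''x'', \<iota> \<rightarrow> \<iota>) := w)"
  let ?in = "in_cantor (v1 ''x'')" and ?cl = "in_closed (v1 ''x'') (v1 ''D'')"
    and ?def = "defined_at (v1 ''F'') (v1 ''x'')"
  let ?out = "Ex ''l'' \<iota> (Ex ''k'' \<iota> (initseg \<cdot> v1 ''x'' \<cdot> v0 ''k'' \<^bold>= v1 ''D'' \<cdot> v0 ''l''))"
  \<comment> \<open>Exactness is assumed on binary sequences only; this alternative supplies the
    others with a witness, as choice demands one for every sequence.\<close>
  let ?nonbin = "Ex ''k'' \<iota> (\<^bold>\<not> v1 ''x'' \<cdot> v0 ''k'' \<^bold>< \<^bold>1 \<oplus> \<^bold>1)"
  have e': "valuation dm ?e" using e D F by simp
  have E: "family ?E"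
    unfolding family_def
  proof (intro allI)
    fix x \<sigma>
    show "\<exists>f\<in>dm ((\<iota> \<rightarrow> \<iota>) \<rightarrow> \<sigma>). \<forall>w\<in>dm (\<iota> \<rightarrow> \<iota>). f \<bullet> w = ?E w (x, \<sigma>)"
      using abstraction[OF e', of "Var x \<sigma>" \<sigma> "\<iota> \<rightarrow> \<iota>" "''x''"] by simp
  qed
  have "semidecidable (\<lambda>w. holds (?E w) ?def)"
    by (rule family_sigma1[OF sigma1_defined_at _ E])
      (simp add: defined_at_def rel_def d_less_def d_add_less_def posrat_def pair_def Exs_def Let_def)
  moreover have "semidecidable (\<lambda>w. holds (?E w) ?out)"
    by (rule family_sigma1[OF _ _ E]) (auto intro!: sigma1.Ex intro: sigma1.qf)
  moreover have "semidecidable (\<lambda>w. holds (?E w) ?nonbin)"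
    by (rule family_sigma1[OF _ _ E]) (auto intro!: sigma1.Ex intro: sigma1.qf)
  moreover have out: "holds (?E w) ?out \<longleftrightarrow> \<not> holds (?E w) ?cl" for w
    by (simp add: in_closed_def)
  moreover have nonbin: "holds (?E w) ?nonbin \<longleftrightarrow> \<not> holds (?E w) ?in" for w
    by (simp add: in_cantor_def)
  moreover have ex: "holds (?E w) ?in \<Longrightarrow> holds (?E w) ?cl \<longleftrightarrow> holds (?E w) ?def"
    if "w \<in> dm (\<iota> \<rightarrow> \<iota>)" for w
    using exact[OF that] by auto
  ultimately obtain \<Phi> where \<Phi>: "\<Phi> \<in> dm ((\<iota> \<rightarrow> \<iota>) \<rightarrow> \<iota>)" and
    "\<And>w. w \<in> dm (\<iota> \<rightarrow> \<iota>) \<Longrightarrow> (\<Phi> \<bullet> w = zer \<longrightarrow> holds (?E w) ?def) \<and>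
      (holds (?E w) ?def \<longrightarrow> holds (?E w) ?out \<or> holds (?E w) ?nonbin \<or> \<Phi> \<bullet> w = zer)"
    using semidecidable_choice[of "\<lambda>w. holds (?E w) ?def" "\<lambda>w. holds (?E w) ?out"
        "\<lambda>w. holds (?E w) ?nonbin"] by blast
  \<comment> \<open>For binary \<open>w\<close> the third alternative fails, and the second
    contradicts definedness by exactness. The two implications obtained from choice thus combine to
    an equivalence.\<close>
  then have "holds (?E w) ?in \<longrightarrow> (holds (?E w) ?cl \<longleftrightarrow> \<Phi> \<bullet> w = zer)"
    if "w \<in> dm (\<iota> \<rightarrow> \<iota>)" for w
    using that ex[OF that] out[of w] nonbin[of w] by blast
  then show ?thesis using \<Phi> by blast
qed

end

section \<open>Completeness and transfer to a formal derivation\<close>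

sublocale RCA_Henkin_set \<subseteq> RCA_model tdom tcon tapp tlt
  by unfold_locales (auto intro: tcon_in tapp_in tapp_ext ex_valuation sat_axiom)

text \<open>Models with carrier \<open>tm\<close> suffice, because the countermodel to an unprovable
  sentence is a term model. For a closed formula substitution does nothing, so truth there is
  membership in \<open>M\<close>.\<close>

lemma RCA_completeness:
  assumes A: "wf_fm A" "fv A = {}" "bvs A \<inter> hvars = {}"
    and valid: "\<And>(dm :: ty \<Rightarrow> tm set) con app lt e. RCA_model dm con app lt \<Longrightarrow> valuation dm e \<Longrightarrow>
      sat dm con app lt e A"
  shows "RCA0\<omega> \<turnstile> A"
proof (rule ccontr)
  have "good A" using A by (simp add: good_def)
  moreover assume "\<not> (RCA0\<omega> \<turnstile> A)"
  ultimately obtain M where "Henkin_set RCA0\<omega> M" "A \<notin> M"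
    using ex_Henkin_set by blast
  then interpret RCA_Henkin_set M by (simp add: RCA_Henkin_set_def)
  obtain e where e: "valuation tdom e" using ex_valuation by blast
  have "sat tdom tcon tapp tlt e A" by (rule valid[OF RCA_model_axioms e])
  then have "fsub e A \<in> M" using truth[of e A] A e by (simp add: valuation_nf)
  moreover have "fsub e A = A" using fsub_cong[of A e "case_prod Var"] A by (simp add: fsub_Var)
  ultimately show False using \<open>A \<notin> M\<close> by simp
qed

theorem theorem2p8:
  shows "RCA0\<omega> \<turnstile>
    All ''D'' (\<iota> \<rightarrow> \<iota>) (All ''F'' (\<iota> \<rightarrow> \<iota>)
      (is_code (v1 ''F'') \<^bold>\<longrightarrow>
       All ''x'' (\<iota> \<rightarrow> \<iota>) (in_cantor (v1 ''x'') \<^bold>\<longrightarrow>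
         in_closed (v1 ''x'') (v1 ''D'') \<^bold>\<longrightarrow> defined_at (v1 ''F'') (v1 ''x'')) \<^bold>\<longrightarrow>
       All ''x'' (\<iota> \<rightarrow> \<iota>) (in_cantor (v1 ''x'') \<^bold>\<longrightarrow>
         (in_closed (v1 ''x'') (v1 ''D'') \<^bold>\<longleftrightarrow> defined_at (v1 ''F'') (v1 ''x''))) \<^bold>\<longrightarrow>
       Ex ''Phi'' ((\<iota> \<rightarrow> \<iota>) \<rightarrow> \<iota>)
         (All ''x'' (\<iota> \<rightarrow> \<iota>) (in_cantor (v1 ''x'') \<^bold>\<longrightarrow>
           (in_closed (v1 ''x'') (v1 ''D'') \<^bold>\<longleftrightarrow> v2 ''Phi'' \<cdot> v1 ''x'' \<^bold>= \<^bold>0)))))"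
proof (rule RCA_completeness)
  let ?A = "All ''D'' (\<iota> \<rightarrow> \<iota>) (All ''F'' (\<iota> \<rightarrow> \<iota>)
      (is_code (v1 ''F'') \<^bold>\<longrightarrow>
       All ''x'' (\<iota> \<rightarrow> \<iota>) (in_cantor (v1 ''x'') \<^bold>\<longrightarrow>
         in_closed (v1 ''x'') (v1 ''D'') \<^bold>\<longrightarrow> defined_at (v1 ''F'') (v1 ''x'')) \<^bold>\<longrightarrow>
       All ''x'' (\<iota> \<rightarrow> \<iota>) (in_cantor (v1 ''x'') \<^bold>\<longrightarrow>
         (in_closed (v1 ''x'') (v1 ''D'') \<^bold>\<longleftrightarrow> defined_at (v1 ''F'') (v1 ''x''))) \<^bold>\<longrightarrow>
       Ex ''Phi'' ((\<iota> \<rightarrow> \<iota>) \<rightarrow> \<iota>)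
         (All ''x'' (\<iota> \<rightarrow> \<iota>) (in_cantor (v1 ''x'') \<^bold>\<longrightarrow>
           (in_closed (v1 ''x'') (v1 ''D'') \<^bold>\<longleftrightarrow> v2 ''Phi'' \<cdot> v1 ''x'' \<^bold>= \<^bold>0)))))"
  note defs = is_code_def in_cantor_def in_closed_def defined_at_def rel_def d_less_def d_add_less_def
    dN_le_add_def dN_add_less_def posrat_def pair_def Exs_def Alls_def Let_def
  show "wf_fm ?A" by (simp add: defs)
  show "fv ?A = {}"
    using fv_is_code[of "v1 ''F''"] fv_defined_at[of "v1 ''F''" "v1 ''x''"] fv_in_cantor[of "v1 ''x''"]
      fv_in_closed[of "v1 ''x''" "v1 ''D''"] by auto
  show "bvs ?A \<inter> hvars = {}" by (simp add: defs)
  fix dm :: "ty \<Rightarrow> tm set" and con app lt e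
  assume "RCA_model dm con app lt" and e: "valuation dm e"
  then interpret RCA_model dm con app lt by simp
  let ?D = "(''D'', \<iota> \<rightarrow> \<iota>)" and ?F = "(''F'', \<iota> \<rightarrow> \<iota>)" and ?x = "(''x'', \<iota> \<rightarrow> \<iota>)"
    and ?P = "(''Phi'', (\<iota> \<rightarrow> \<iota>) \<rightarrow> \<iota>)"
  let ?in = "in_cantor (v1 ''x'')" and ?cl = "in_closed (v1 ''x'') (v1 ''D'')"
  \<comment> \<open>The valuation that arises from the existential quantifier also assigns
    \<open>\<Phi>\<close>; the formulas about \<open>x\<close> and \<open>D\<close> do not see this
    assignment.\<close>
  have irr: "holds (e(?D := D, ?F := F, ?P := \<Phi>, ?x := w)) ?in = holds (e(?D := D, ?F := F, ?x := w)) ?in"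
    "holds (e(?D := D, ?F := F, ?P := \<Phi>, ?x := w)) ?cl = holds (e(?D := D, ?F := F, ?x := w)) ?cl"
    for D F \<Phi> w
    by (rule sat_cong; auto simp: in_cantor_def in_closed_def)+
  let ?def = "defined_at (v1 ''F'') (v1 ''x'')"
  have "holds (e(?D := D, ?F := F)) (Ex ''Phi'' ((\<iota> \<rightarrow> \<iota>) \<rightarrow> \<iota>)
      (All ''x'' (\<iota> \<rightarrow> \<iota>) (?in \<^bold>\<longrightarrow> (?cl \<^bold>\<longleftrightarrow> v2 ''Phi'' \<cdot> v1 ''x'' \<^bold>= \<^bold>0))))"
    if "D \<in> dm (\<iota> \<rightarrow> \<iota>)" "F \<in> dm (\<iota> \<rightarrow> \<iota>)"
      "holds (e(?D := D, ?F := F)) (All ''x'' (\<iota> \<rightarrow> \<iota>) (?in \<^bold>\<longrightarrow> (?cl \<^bold>\<longleftrightarrow> ?def)))" for D F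
  proof -
    have "holds (e(?D := D, ?F := F, ?x := w)) (?in \<^bold>\<longrightarrow> (?cl \<^bold>\<longleftrightarrow> ?def))" if "w \<in> dm (\<iota> \<rightarrow> \<iota>)" for w
      using \<open>holds _ (All _ _ _)\<close> that unfolding sat.simps(5) by blast
    from holds_decidability[OF e \<open>D \<in> _\<close> \<open>F \<in> _\<close> this]
    obtain \<Phi> where "\<Phi> \<in> dm ((\<iota> \<rightarrow> \<iota>) \<rightarrow> \<iota>)" and
      "\<And>w. w \<in> dm (\<iota> \<rightarrow> \<iota>) \<Longrightarrow> holds (e(?D := D, ?F := F, ?x := w)) ?in \<Longrightarrow>
        holds (e(?D := D, ?F := F, ?x := w)) ?cl \<longleftrightarrow> app \<Phi> w = zer"
      by blast
    then show ?thesis by (auto simp: irr intro!: bexI[of _ \<Phi>])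
  qed
  then show "holds e ?A" by (subst sat.simps, subst sat.simps) (simp only: sat.simps(4), blast)
qed

end
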